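(* Let $m\geqslant 3$ be an integer. Then, up to orthogonal transformation, the tight spherical $5$-designs in $S^{m-1}$ are in bijection with the isomorphism classes of nonbipartite Taylor graphs with intersection array $\{k,\mu,1;1,\mu,k\}$, where $$k=\frac{(m-1)(m+2)}{2},\qquad \mu=\frac{m^2+m-4-(m-3)\sqrt{m+2}}{4}.$$
   Context: A nonempty finite subset $\Omega\subset S^{m-1}$ (the unit sphere in $\mathbb{R}^m$) is a spherical $t$-design if the average over $S^{m-1}$ (normalized surface measure) of every polynomial of degree at most $t$ in $m$ variables equals its average over $\Omega$. Every spherical $5$-design in $S^{m-1}$ satisfies $|\Omega|\geqslant 2\binom{m+1}{2}$, and it is called tight if equality holds. A nonbipartite Taylor graph is a nonbipartite distance-regular antipodal double-cover with diameter $3$ of a complete graph. A connected graph of diameter $d$ is distance-regular with intersection array $\{b_0,\dots,b_{d-1};c_1,\dots,c_d\}$ if, for any vertices $x,y$ at path-length distance $i$, the numbers of neighbours of $y$ at distance $i+1$ and $i-1$ from $x$ depend only on $i$ and equal $b_i$ (for $0\leqslant i\leqslant d-1$) and $c_i$ (for $1\leqslant i\leqslant d$), respectively. The intersection array of a Taylor graph has the form $\{k,\mu,1;1,\mu,k\}$. *)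

theory Defs
  imports
    "HOL-Analysis.Analysis"
    "Graph_Theory.Digraph_Isomorphism"
    "Graph_Theory.Vertex_Walk"
    "Graph_Theory.Kuratowski"
begin

section \<open>Spherical designs\<close>

text \<open>The library has no surface measure on spheres. We use the classical polar-coordinate
  description: the normalized surface measure of a Borel set \<open>A\<close> of the unit sphere is the
  proportion of the unit ball occupied by the cone over \<open>A\<close>, i.e. it is the image of the uniform
  distribution on the ball under the radial projection \<open>sgn x = x /\<^sub>R norm x\<close>. The value
  \<open>sgn 0 = 0\<close> only concerns a null set. The measure is defined on the Borel sets of the whole
  space and is concentrated on the sphere.\<close>

definition sphere_measure :: "'a::euclidean_space measure" where
  "sphere_measure = distr (uniform_measure lborel (ball 0 1)) borel sgn"

lemma emeasure_sphere_measure: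
  fixes A :: "'a::euclidean_space set"
  assumes "A \<in> sets borel"
  shows "emeasure sphere_measure A =
    emeasure lborel {x \<in> ball 0 1. sgn x \<in> A} / emeasure lborel (ball (0::'a) 1)"
proof -
  have sgn: "(sgn :: 'a \<Rightarrow> 'a) \<in> borel_measurable borel"
    by simp
  have "emeasure sphere_measure A =
      emeasure (uniform_measure lborel (ball (0::'a) 1)) (sgn -` A)"
    unfolding sphere_measure_def using assms sgn by (subst emeasure_distr) auto
  also have "\<dots> = emeasure lborel (ball 0 1 \<inter> sgn -` A) / emeasure lborel (ball (0::'a) 1)"
    using measurable_sets[OF sgn assms] by (intro emeasure_uniform_measure) auto
  finally show ?thesis
    by (simp add: Int_def vimage_def)
qed

lemma emeasure_sphere_measure_UNIV:
  "emeasure (sphere_measure :: 'a::euclidean_space measure) UNIV = 1"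
proof -
  have "emeasure lborel (ball (0::'a) 1) \<noteq> 0" "emeasure lborel (ball (0::'a) 1) \<noteq> \<infinity>"
    by (simp_all add: emeasure_ball unit_ball_vol_pos[THEN less_imp_neq, symmetric])
  then show ?thesis
    by (simp add: emeasure_sphere_measure ball_def less_top[symmetric])
qed

text \<open>Polynomials are sums of monomials indexed by their exponent vectors \<open>a\<close>.\<close>

definition polynomial_of_degree_le :: "nat \<Rightarrow> (real ^ 'n::finite \<Rightarrow> real) \<Rightarrow> bool" where
  "polynomial_of_degree_le t p \<longleftrightarrow>
    (\<exists>c. p = (\<lambda>x. \<Sum>a | (\<Sum>i\<in>UNIV. a i) \<le> t. c a * (\<Prod>i\<in>UNIV. (x $ i) ^ a i)))"

lemma finite_exponents: "finite {a :: 'n::finite \<Rightarrow> nat. (\<Sum>i\<in>UNIV. a i) \<le> t}"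
proof (rule finite_subset)
  show "{a :: 'n \<Rightarrow> nat. (\<Sum>i\<in>UNIV. a i) \<le> t} \<subseteq> PiE UNIV (\<lambda>_. {..t})"
  proof
    fix a :: "'n \<Rightarrow> nat" assume a: "a \<in> {a. (\<Sum>i\<in>UNIV. a i) \<le> t}"
    have "a i \<le> t" for i
      using a member_le_sum[of i UNIV a] by simp
    then show "a \<in> PiE UNIV (\<lambda>_. {..t})"
      by (simp add: PiE_UNIV_domain)
  qed
qed (simp add: finite_PiE)

definition spherical_design :: "nat \<Rightarrow> (real ^ 'n::finite) set \<Rightarrow> bool" where
  "spherical_design t \<Omega> \<longleftrightarrow> finite \<Omega> \<and> \<Omega> \<noteq> {} \<and> \<Omega> \<subseteq> sphere 0 1 \<and>
    (\<forall>p. polynomial_of_degree_le t p \<longrightarrow>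
      (LINT x|sphere_measure. p x) = (\<Sum>x\<in>\<Omega>. p x) / real (card \<Omega>))"

definition tight_spherical_5_design :: "(real ^ 'n::finite) set \<Rightarrow> bool" where
  "tight_spherical_5_design \<Omega> \<longleftrightarrow>
    spherical_design 5 \<Omega> \<and> card \<Omega> = 2 * ((CARD('n) + 1) choose 2)"

definition orthogonal_equivalence :: "((real ^ 'n::finite) set \<times> (real ^ 'n) set) set" where
  "orthogonal_equivalence = {(\<Omega>, \<Omega>'). \<exists>f. orthogonal_transformation f \<and> f ` \<Omega> = \<Omega>'}"

lemma equiv_orthogonal_equivalence: "equiv UNIV orthogonal_equivalence"
proof (intro equivI refl_onI symI transI)
  fix A :: "(real ^ 'n) set"
  show "(A, A) \<in> orthogonal_equivalence"
    by (auto simp: orthogonal_equivalence_def intro!: exI[of _ "\<lambda>x. x"]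
        orthogonal_transformation_id)
next
  fix A B :: "(real ^ 'n) set"
  assume "(A, B) \<in> orthogonal_equivalence"
  then obtain f where f: "orthogonal_transformation f" "f ` A = B"
    by (auto simp: orthogonal_equivalence_def)
  then have "inv f ` B = A"
    by (metis image_inv_f_f orthogonal_transformation_inj)
  then show "(B, A) \<in> orthogonal_equivalence"
    using f by (auto simp: orthogonal_equivalence_def intro: orthogonal_transformation_inv)
next
  fix A B C :: "(real ^ 'n) set"
  assume "(A, B) \<in> orthogonal_equivalence" "(B, C) \<in> orthogonal_equivalence"
  then obtain f g where "orthogonal_transformation f" "f ` A = B"
    "orthogonal_transformation g" "g ` B = C"
    by (auto simp: orthogonal_equivalence_def)
  then show "(A, C) \<in> orthogonal_equivalence"
    by (auto simp: orthogonal_equivalence_def image_comp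
        intro!: exI[of _ "g \<circ> f"] orthogonal_transformation_compose)
qed auto

section \<open>Distance-regular graphs and Taylor graphs\<close>

text \<open>Finite simple graphs are the \<open>pair_graph\<close>s of the library: finite, loopless, with a symmetric
  set of arcs. Note that \<open>connected\<close> must be qualified to mean the graph-theoretic notion.\<close>

definition neighbours :: "'a pair_pre_digraph \<Rightarrow> 'a \<Rightarrow> 'a set" where
  "neighbours G x = {y. (x, y) \<in> parcs G}"

text \<open>Path-length distance and diameter; only meaningful for connected graphs.\<close>

definition graph_dist :: "'a pair_pre_digraph \<Rightarrow> 'a \<Rightarrow> 'a \<Rightarrow> nat" where
  "graph_dist G x y =
    (LEAST n. \<exists>p. vwalk p (with_proj G) \<and> hd p = x \<and> last p = y \<and> vwalk_length p = n)"

definition graph_diameter :: "'a pair_pre_digraph \<Rightarrow> nat" where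
  "graph_diameter G = Max {graph_dist G x y | x y. x \<in> pverts G \<and> y \<in> pverts G}"

text \<open>The list \<open>bs\<close> is \<open>b\<^sub>0, \<dots>, b\<^sub>d\<^sub>-\<^sub>1\<close>, whereas \<open>cs\<close> is \<open>c\<^sub>1, \<dots>, c\<^sub>d\<close>; so \<open>c\<^sub>i\<close> is \<open>cs ! (i - 1)\<close>.\<close>

definition has_intersection_array :: "'a pair_pre_digraph \<Rightarrow> nat list \<Rightarrow> nat list \<Rightarrow> bool" where
  "has_intersection_array G bs cs \<longleftrightarrow>
    pair_graph G \<and> Digraph_Component.connected (with_proj G) \<and>
    length bs = graph_diameter G \<and> length cs = graph_diameter G \<and>
    (\<forall>x\<in>pverts G. \<forall>y\<in>pverts G.
      (graph_dist G x y < graph_diameter G \<longrightarrow>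
        card {z \<in> neighbours G y. graph_dist G x z = graph_dist G x y + 1}
          = bs ! graph_dist G x y) \<and>
      (1 \<le> graph_dist G x y \<longrightarrow>
        card {z \<in> neighbours G y. graph_dist G x z = graph_dist G x y - 1}
          = cs ! (graph_dist G x y - 1)))"

definition distance_regular :: "'a pair_pre_digraph \<Rightarrow> bool" where
  "distance_regular G \<longleftrightarrow> (\<exists>bs cs. has_intersection_array G bs cs)"

definition bipartite :: "'a pair_pre_digraph \<Rightarrow> bool" where
  "bipartite G \<longleftrightarrow>
    (\<exists>A B. A \<union> B = pverts G \<and> A \<inter> B = {} \<and> parcs G \<subseteq> A \<times> B \<union> B \<times> A)"

definition antipodal_rel :: "'a pair_pre_digraph \<Rightarrow> 'a rel" where
  "antipodal_rel G =
    {(x, y). x \<in> pverts G \<and> y \<in> pverts G \<and> graph_dist G x y \<in> {0, graph_diameter G}}"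

definition antipodal :: "'a pair_pre_digraph \<Rightarrow> bool" where
  "antipodal G \<longleftrightarrow> equiv (pverts G) (antipodal_rel G)"

text \<open>The graph on the antipodal classes (the fibres), distinct classes being adjacent whenever
  some edge joins them.\<close>

definition folded_graph :: "'a pair_pre_digraph \<Rightarrow> 'a set pair_pre_digraph" where
  "folded_graph G = \<lparr> pverts = pverts G // antipodal_rel G,
     parcs = {(A, B). A \<in> pverts G // antipodal_rel G \<and> B \<in> pverts G // antipodal_rel G \<and>
       A \<noteq> B \<and> (\<exists>x\<in>A. \<exists>y\<in>B. (x, y) \<in> parcs G)} \<rparr>"

text \<open>\<open>G\<close> is an antipodal double-cover of its folded graph: all fibres have two elements, and the
  projection onto the folded graph is a covering map, i.e. a bijection on each neighbourhood.\<close>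

definition antipodal_double_cover :: "'a pair_pre_digraph \<Rightarrow> bool" where
  "antipodal_double_cover G \<longleftrightarrow> antipodal G \<and>
    (\<forall>A \<in> pverts G // antipodal_rel G. card A = 2) \<and>
    (\<forall>x\<in>pverts G. bij_betw (\<lambda>y. antipodal_rel G `` {y}) (neighbours G x)
       (neighbours (folded_graph G) (antipodal_rel G `` {x})))"

definition taylor_graph :: "'a pair_pre_digraph \<Rightarrow> bool" where
  "taylor_graph G \<longleftrightarrow> distance_regular G \<and> graph_diameter G = 3 \<and> antipodal_double_cover G \<and>
    (\<exists>n. complete_digraph n (with_proj (folded_graph G)))"

text \<open>Isomorphism of graphs with vertices in a fixed type. Since every finite graph is isomorphic
  to one whose vertices are natural numbers, the isomorphism classes of finite graphs are
  represented by the classes of this relation on \<open>nat pair_pre_digraph\<close>.\<close>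

definition graph_isomorphism_rel :: "'a pair_pre_digraph rel" where
  "graph_isomorphism_rel =
    {(G, H). pair_graph G \<and> pair_graph H \<and> digraph_iso (with_proj G) (with_proj H)}"

lemma equiv_graph_isomorphism_rel: "equiv {G. pair_graph G} graph_isomorphism_rel"
proof (intro equivI refl_onI symI transI)
  fix G :: "'a pair_pre_digraph" assume "G \<in> {G. pair_graph G}"
  then interpret pair_graph G by simp
  show "(G, G) \<in> graph_isomorphism_rel"
    unfolding graph_isomorphism_rel_def digraph_iso_def
    by (auto intro!: exI[of _ "\<lparr>iso_verts = id, iso_arcs = id, iso_head = snd, iso_tail = fst\<rparr>"]
        simp: pre_digraph.digraph_isomorphism_def app_iso_def with_proj_def wf_digraph_axioms
          pair_graph_axioms wf_digraph_axioms[unfolded with_proj_def])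
next
  fix G H :: "'a pair_pre_digraph" assume "(G, H) \<in> graph_isomorphism_rel"
  then show "(H, G) \<in> graph_isomorphism_rel"
    by (auto simp: graph_isomorphism_rel_def wf_digraph_wp_iff pair_graph_def pair_digraph_def
        pair_fin_digraph_def intro!: digraph_iso_swap)
next
  fix G H K :: "'a pair_pre_digraph"
  assume "(G, H) \<in> graph_isomorphism_rel" "(H, K) \<in> graph_isomorphism_rel"
  then show "(G, K) \<in> graph_isomorphism_rel"
    by (auto simp: graph_isomorphism_rel_def intro: digraph_iso_trans)
qed (auto simp: graph_isomorphism_rel_def)

end

theory Submission
  imports Defs "HOL-Probability.Probability_Measure"
begin

text \<open>Both sides of the correspondence are encoded by the same Gram matrices. Write \<open>\<alpha> = 1 / sqrt (m + 2)\<close>.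

  From designs to graphs. A tight 5-design has \<open>m (m + 1)\<close> points, and equality in the linear
  programming bound for the polynomial \<open>(1 + t) * (t\<^sup>2 - \<alpha>\<^sup>2)\<^sup>2\<close> shows that distinct points have inner product
  \<open>-1\<close> or \<open>\<plusminus>\<alpha>\<close> (\<open>tight_spherical_5_design_inner\<close>); the odd moments show that the design is antipodal. Join two
  points when their inner product is \<open>\<alpha>\<close>. The second moments say that the Gram matrix \<open>g\<close> satisfies
  \<open>g * g = (m + 1) * g\<close>, and the entries of this equation are the intersection
  numbers \<open>k\<close> and \<open>\<mu>\<close> (\<open>card_nbrs\<close>, \<open>card_nbrs_far\<close>). Since \<open>\<mu> > 0\<close>, the inner products
  \<open>1, \<alpha>, - \<alpha>, -1\<close> correspond to the distances \<open>0, 1, 2, 3\<close>, and the graph is a Taylor graph; it contains triangles.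

  From graphs to designs. In a Taylor graph replace the distances \<open>0, 1, 2, 3\<close> by \<open>1, \<alpha>, - \<alpha>, -1\<close>. The intersection
  array gives the same matrix equation (\<open>taylor_graph_imp_gram\<close>), so \<open>g / (m + 1)\<close> is an orthogonal projection of
  trace \<open>m\<close>, and \<open>g\<close> is the Gram matrix of vectors in dimension \<open>m\<close> (\<open>realization\<close>). These vectors form a
  5-design: the squared norm of the tensor of fourth order cubature errors is determined by
  \<open>\<Sum>x y. (x \<bullet> y) ^ 4\<close> and turns out to be zero (\<open>discrepancy_degree_4\<close>), lower even degrees follow on the sphere, and
  odd degrees vanish by antipodality.

  Equivalence. Adjacency determines the Gram matrix (\<open>gram_eq_adjacency\<close>), and two tight frames with the same
  Gram matrix differ by an orthogonal transformation (\<open>isometry_of_equal_gram\<close>). So designs are orthogonally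
  equivalent iff their graphs are isomorphic (\<open>realizes_equivalence\<close>).

  The only analytic input is the second and the fourth moment of the surface measure. They follow from rotation invariance,
  which in turn comes from the rotation invariance of Lebesgue measure.\<close>

section \<open>Moments of the surface measure\<close>

lemma nn_integral_lborel_translate:
  fixes c :: "'a::euclidean_space"
  assumes "g \<in> borel_measurable borel"
  shows "(\<integral>\<^sup>+x. g (c + x) \<partial>lborel) = (\<integral>\<^sup>+x. g x \<partial>lborel)"
proof -
  have "(\<integral>\<^sup>+x. g x \<partial>lborel) = (\<integral>\<^sup>+x. g x \<partial>distr lborel borel ((+) c))"
    by (simp add: lborel_distr_plus)
  also have "\<dots> = (\<integral>\<^sup>+x. g (c + x) \<partial>lborel)"
    using assms by (intro nn_integral_distr) auto
  finally show ?thesis ..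
qed

text \<open>Lebesgue measure is the only translation invariant measure giving the unit ball its volume,
  and a linear isometry preserves both properties. The uniqueness argument is Weil's: integrate
  \<open>B (f x) * G y\<close> over all pairs \<open>(x, y)\<close>, where \<open>B\<close> is the indicator of the unit ball, and move
  the dependence on \<open>f\<close> from \<open>B\<close> to \<open>G\<close> by translating and exchanging the two integrals.\<close>

lemma nn_integral_lborel_orthogonal:
  fixes f :: "'a::euclidean_space \<Rightarrow> 'a"
  assumes f: "orthogonal_transformation f" and G[measurable]: "G \<in> borel_measurable borel"
  shows "(\<integral>\<^sup>+x. G (f x) \<partial>lborel) = (\<integral>\<^sup>+x. G x \<partial>lborel)"
proof -
  define B where "B = (indicator (ball 0 1) :: 'a \<Rightarrow> ennreal)"
  have lin: "linear f"
    using f by (rule orthogonal_transformation_linear)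
  have fm[measurable]: "f \<in> borel_measurable borel"
    using lin by (intro borel_measurable_continuous_onI linear_continuous_on) (simp add: linear_conv_bounded_linear)
  have Bm[measurable]: "B \<in> borel_measurable borel"
    unfolding B_def by (intro borel_measurable_indicator) simp
  have norm_f: "norm (f x) = norm x" for x
    using f by (rule orthogonal_transformation_norm)
  have surj: "f (inv f y) = y" for y
    using orthogonal_transformation_surj[OF f] by (rule surj_f_inv_f)
  define v where "v = (\<integral>\<^sup>+x. B x \<partial>lborel)"
  have v: "v \<noteq> 0" "v \<noteq> \<infinity>"
    unfolding v_def B_def
    by (simp_all add: emeasure_ball unit_ball_vol_pos[THEN less_imp_neq, symmetric])
  have "v * (\<integral>\<^sup>+y. G y \<partial>lborel) = (\<integral>\<^sup>+x. B (f x) * (\<integral>\<^sup>+y. G y \<partial>lborel) \<partial>lborel)"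
    by (subst nn_integral_multc) (auto simp: v_def B_def indicator_def norm_f)
  also have "\<dots> = (\<integral>\<^sup>+x. (\<integral>\<^sup>+y. B (f x) * G (f x + y) \<partial>lborel) \<partial>lborel)"
    by (simp add: nn_integral_cmult nn_integral_lborel_translate)
  also have "\<dots> = (\<integral>\<^sup>+y. (\<integral>\<^sup>+x. B (f x) * G (f x + y) \<partial>lborel) \<partial>lborel)"
    by (intro lborel_pair.Fubini') simp
  also have "\<dots> = (\<integral>\<^sup>+y. (\<integral>\<^sup>+x. B (f x - y) * G (f x) \<partial>lborel) \<partial>lborel)"
  proof (rule nn_integral_cong)
    fix y :: 'a
    have shift: "f (x - inv f y) = f x - y" for x
      using linear_diff[OF lin, of x "inv f y"] by (simp add: surj)
    have "(\<integral>\<^sup>+x. B (f (- inv f y + x)) * G (f (- inv f y + x) + y) \<partial>lborel)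
        = (\<integral>\<^sup>+x. B (f x) * G (f x + y) \<partial>lborel)"
      by (rule nn_integral_lborel_translate[where g = "\<lambda>x. B (f x) * G (f x + y)"]) simp
    then show "(\<integral>\<^sup>+x. B (f x) * G (f x + y) \<partial>lborel)
        = (\<integral>\<^sup>+x. B (f x - y) * G (f x) \<partial>lborel)"
      by (simp add: shift)
  qed
  also have "\<dots> = (\<integral>\<^sup>+x. (\<integral>\<^sup>+y. B (f x - y) * G (f x) \<partial>lborel) \<partial>lborel)"
    by (intro lborel_pair.Fubini') simp
  also have "\<dots> = (\<integral>\<^sup>+x. v * G (f x) \<partial>lborel)"
  proof (rule nn_integral_cong)
    fix x :: 'a
    have "(\<integral>\<^sup>+y. B (f x - y) \<partial>lborel) = (\<integral>\<^sup>+y. B (- f x + y) \<partial>lborel)"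
      by (simp add: B_def indicator_def norm_minus_commute)
    also have "\<dots> = v"
      unfolding v_def by (rule nn_integral_lborel_translate) simp
    finally show "(\<integral>\<^sup>+y. B (f x - y) * G (f x) \<partial>lborel) = v * G (f x)"
      by (simp add: nn_integral_multc)
  qed
  also have "\<dots> = v * (\<integral>\<^sup>+x. G (f x) \<partial>lborel)"
    by (simp add: nn_integral_cmult)
  finally show ?thesis
    using v by (metis ennreal_mult_cancel_left infinity_ennreal_def)
qed

lemma prob_space_sphere_measure: "prob_space (sphere_measure :: 'a::euclidean_space measure)"
proof
  show "emeasure sphere_measure (space (sphere_measure :: 'a measure)) = 1"
    using emeasure_sphere_measure_UNIV by (simp add: sphere_measure_def)
qed

interpretation sphere: prob_space "sphere_measure :: 'a::euclidean_space measure"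
  by (rule prob_space_sphere_measure)

lemma sets_sphere_measure[measurable_cong, simp]: "sets sphere_measure = sets borel"
  by (simp add: sphere_measure_def)

lemma space_sphere_measure[simp]: "space sphere_measure = UNIV"
  by (simp add: sphere_measure_def)

lemma borel_measurable_sphere_measure[simp]: "borel_measurable sphere_measure = borel_measurable borel"
  by (rule measurable_cong_sets) simp_all

text \<open>The measure lives on the unit sphere. Together with rotation invariance this determines the second
  and fourth moments.\<close>

lemma AE_sphere_measure_norm: "AE x in (sphere_measure :: 'a::euclidean_space measure). norm x = 1"
proof -
  have "AE x in (lborel :: 'a measure). norm (sgn x) = 1"
    using AE_lborel_singleton[of "0 :: 'a"] by eventually_elim (simp add: norm_sgn)
  then have "AE x in uniform_measure lborel (ball (0::'a) 1). norm (sgn x) = 1"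
    by (intro AE_uniform_measureI) auto
  then show ?thesis
    unfolding sphere_measure_def by (subst AE_distr_iff) auto
qed

lemma integrable_sphere_measure:
  fixes g :: "'a::euclidean_space \<Rightarrow> real"
  assumes "continuous_on UNIV g"
  shows "integrable sphere_measure g"
proof -
  have "compact (g ` sphere 0 1)"
    using assms by (intro compact_continuous_image) (auto intro: continuous_on_subset)
  then have "bounded (g ` sphere 0 1)"
    by (rule compact_imp_bounded)
  then obtain b where b: "\<forall>y \<in> g ` sphere 0 1. norm y \<le> b"
    unfolding bounded_iff ..
  show ?thesis
  proof (rule sphere.integrable_const_bound[where B = b])
    show "AE x in sphere_measure. norm (g x) \<le> b"
      using AE_sphere_measure_norm by eventually_elim (use b in auto)
    show "g \<in> borel_measurable sphere_measure"
      using borel_measurable_continuous_onI[OF assms] by simp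
  qed
qed

lemma distr_sphere_measure_orthogonal:
  fixes f :: "'a::euclidean_space \<Rightarrow> 'a"
  assumes f: "orthogonal_transformation f"
  shows "distr sphere_measure borel f = sphere_measure"
proof (rule measure_eqI)
  have lin: "linear f"
    using f by (rule orthogonal_transformation_linear)
  have fm[measurable]: "f \<in> borel_measurable borel"
    using lin by (intro borel_measurable_continuous_onI linear_continuous_on) (simp add: linear_conv_bounded_linear)
  have norm_f: "norm (f x) = norm x" for x
    using f by (rule orthogonal_transformation_norm)
  fix A assume "A \<in> sets (distr sphere_measure borel f)"
  then have A[measurable]: "A \<in> sets borel" by simp
  have [measurable]: "ball 0 1 \<in> sets (borel :: 'a measure)"
    by simp
  have eq: "emeasure lborel {x \<in> ball 0 1. sgn x \<in> A'}
      = (\<integral>\<^sup>+x. indicator (ball 0 1) x * indicator A' (sgn x) \<partial>lborel)"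
    if [measurable]: "A' \<in> sets borel" for A' :: "'a set"
  proof -
    have "{x \<in> ball 0 1. sgn x \<in> A'} \<in> sets lborel"
      using that by measurable
    then have "emeasure lborel {x \<in> ball 0 1. sgn x \<in> A'}
        = (\<integral>\<^sup>+x. indicator {x \<in> ball 0 1. sgn x \<in> A'} x \<partial>lborel)"
      by (rule nn_integral_indicator[symmetric])
    also have "\<dots> = (\<integral>\<^sup>+x. indicator (ball 0 1) x * indicator A' (sgn x) \<partial>lborel)"
      by (intro nn_integral_cong) (simp add: indicator_def)
    finally show ?thesis .
  qed
  have fA[measurable]: "f -` A \<in> sets borel"
    using measurable_sets[OF fm A] by simp
  have "emeasure (distr sphere_measure borel f) A = emeasure sphere_measure (f -` A)"
    by (subst emeasure_distr) auto
  also have "\<dots> = emeasure sphere_measure A"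
  proof -
    have "(\<integral>\<^sup>+x. indicator (ball 0 1) x * indicator (f -` A) (sgn x) \<partial>lborel)
        = (\<integral>\<^sup>+x. indicator (ball 0 1) (f x) * indicator A (sgn (f x)) \<partial>lborel)"
      by (auto intro!: nn_integral_cong simp: indicator_def norm_f sgn_div_norm linear_scale[OF lin])
    also have "\<dots> = (\<integral>\<^sup>+x. indicator (ball 0 1) x * indicator A (sgn x) \<partial>lborel)"
      by (rule nn_integral_lborel_orthogonal[OF f]) measurable
    finally show ?thesis
      unfolding emeasure_sphere_measure[OF A] emeasure_sphere_measure[OF fA] eq[OF A] eq[OF fA]
      by (rule arg_cong)
  qed
  finally show "emeasure (distr sphere_measure borel f) A = emeasure sphere_measure A" .
qed simp

lemma sphere_integral_orthogonal:
  fixes f :: "'a::euclidean_space \<Rightarrow> 'a" and g :: "'a::euclidean_space \<Rightarrow> real"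
  assumes "orthogonal_transformation f" "continuous_on UNIV g"
  shows "(LINT u|sphere_measure. g (f u)) = (LINT u|sphere_measure. g u)"
proof -
  have [measurable]: "f \<in> borel_measurable borel"
    using orthogonal_transformation_linear[OF assms(1)]
    by (intro borel_measurable_continuous_onI linear_continuous_on) (simp add: linear_conv_bounded_linear)
  have "(LINT u|sphere_measure. g u) = (LINT u|distr sphere_measure borel f. g u)"
    by (simp add: distr_sphere_measure_orthogonal[OF assms(1)])
  also have "\<dots> = (LINT u|sphere_measure. g (f u))"
    using borel_measurable_continuous_onI[OF assms(2)] by (intro integral_distr) auto
  finally show ?thesis ..
qed

lemma sphere_integral_odd:
  fixes g :: "'a::euclidean_space \<Rightarrow> real"
  assumes "continuous_on UNIV g" "\<And>u. g (- u) = - g u"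
  shows "(LINT u|sphere_measure. g u) = 0"
proof -
  have "(LINT u|sphere_measure. g (- u)) = (LINT u|sphere_measure. g u)"
    using sphere_integral_orthogonal[OF _ assms(1), of uminus]
    by (simp add: orthogonal_transformation_neg)
  then show ?thesis
    by (simp add: assms(2))
qed

lemma measure_sphere_measure_UNIV[simp]:
  "measure (sphere_measure :: 'a::euclidean_space measure) UNIV = 1"
  using prob_space.prob_space[OF prob_space_sphere_measure[where 'a = 'a]] by simp

lemma sphere_integral_const: "(LINT u|(sphere_measure :: 'a::euclidean_space measure). c :: real) = c"
  by simp

lemma sphere_integral_cong:
  fixes g h :: "'a::euclidean_space \<Rightarrow> real"
  assumes "continuous_on UNIV g" "continuous_on UNIV h" "\<And>u. norm u = 1 \<Longrightarrow> g u = h u"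
  shows "(LINT u|sphere_measure. g u) = (LINT u|sphere_measure. h u)"
proof (rule integral_cong_AE)
  show "AE u in sphere_measure. g u = h u"
    using AE_sphere_measure_norm by eventually_elim (rule assms)
qed (simp_all add: assms borel_measurable_continuous_onI)

text \<open>By rotation invariance a moment of the linear form \<open>(\<bullet>) y\<close> depends on \<open>y\<close> only through its
  norm.\<close>

lemma sphere_integral_inner_power:
  fixes y :: "real ^ 'n::finite" and i :: 'n
  shows "(LINT u|sphere_measure. (y \<bullet> u) ^ k) = norm y ^ k * (LINT u|sphere_measure. (u $ i) ^ k)"
proof -
  obtain f where f: "orthogonal_transformation f" "f (norm y *\<^sub>R (axis i 1 :: real ^ 'n)) = y"
    by (rule orthogonal_transformation_exists[of "norm y *\<^sub>R axis i 1 :: real ^ 'n" y]) simp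
  have "(LINT u|sphere_measure. (y \<bullet> u) ^ k) = (LINT u|sphere_measure. (y \<bullet> f u) ^ k)"
    by (rule sphere_integral_orthogonal[OF f(1), symmetric]) (intro continuous_intros)
  also have "\<dots> = (LINT u|sphere_measure. (norm y * u $ i) ^ k)"
  proof -
    have "y \<bullet> f u = norm y * u $ i" for u
    proof -
      have "y \<bullet> f u = f (norm y *\<^sub>R axis i 1) \<bullet> f u"
        by (simp only: f(2))
      also have "\<dots> = (norm y *\<^sub>R axis i 1) \<bullet> u"
        using f(1) by (simp add: orthogonal_transformation_def)
      finally show ?thesis by (simp add: inner_axis')
    qed
    then show ?thesis by simp
  qed
  finally show ?thesis
    by (simp add: power_mult_distrib)
qed

lemma sphere_integral_inner_power2:
  fixes y :: "real ^ 'n::finite"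
  shows "(LINT u|sphere_measure. (y \<bullet> u)\<^sup>2) = (norm y)\<^sup>2 / real CARD('n)"
proof -
  obtain i :: 'n where True by simp
  define c where "c = (LINT u|(sphere_measure :: (real ^ 'n) measure). (u $ i)\<^sup>2)"
  have c: "(LINT u|(sphere_measure :: (real ^ 'n) measure). (u $ j)\<^sup>2) = c" for j
    using sphere_integral_inner_power[of "axis j 1" 2 i] by (simp add: c_def inner_axis')
  have "(1 :: real) = (LINT u|(sphere_measure :: (real ^ 'n) measure). 1)"
    by (rule sphere_integral_const[symmetric])
  also have "\<dots> = (LINT u|(sphere_measure :: (real ^ 'n) measure). (\<Sum>j\<in>UNIV. (u $ j)\<^sup>2))"
  proof (rule sphere_integral_cong)
    fix u :: "real ^ 'n" assume "norm u = 1"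
    then show "1 = (\<Sum>j\<in>UNIV. (u $ j)\<^sup>2)"
      by (simp add: norm_vec_def L2_set_def)
  qed (intro continuous_intros)+
  also have "\<dots> = (\<Sum>j\<in>UNIV. (LINT u|(sphere_measure :: (real ^ 'n) measure). (u $ j)\<^sup>2))"
    by (rule Bochner_Integration.integral_sum) (intro integrable_sphere_measure continuous_intros)
  also have "\<dots> = real CARD('n) * c"
    by (simp add: c)
  finally have "c = 1 / real CARD('n)"
    by (simp add: field_simps)
  then show ?thesis
    using sphere_integral_inner_power[of y 2 i] by (simp add: c_def)
qed

text \<open>Rotating by \<open>45\<close> degrees in a coordinate plane relates the mean \<open>c\<close> of \<open>u\<^sub>i\<^sup>4\<close> to that of
  \<open>u\<^sub>i\<^sup>2 u\<^sub>j\<^sup>2\<close>, which is \<open>c / 3\<close>; then \<open>c\<close> is determined by \<open>norm u ^ 4 = 1\<close>.\<close>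

lemma sphere_integral_inner_power4:
  fixes y :: "real ^ 'n::finite"
  shows "(LINT u|sphere_measure. (y \<bullet> u) ^ 4)
    = 3 * norm y ^ 4 / (real CARD('n) * (real CARD('n) + 2))"
proof -
  let ?I = "\<lambda>g :: real ^ 'n \<Rightarrow> real. LINT u|sphere_measure. g u"
  obtain i :: 'n where True by simp
  define c where "c = ?I (\<lambda>u. (u $ i) ^ 4)"
  have c: "?I (\<lambda>u. (u $ j) ^ 4) = c" for j
    using sphere_integral_inner_power[of "axis j 1" 4 i] by (simp add: c_def inner_axis')
  have mixed: "?I (\<lambda>u. (u $ j)\<^sup>2 * (u $ k)\<^sup>2) = c / 3" if "j \<noteq> k" for j k
  proof -
    have p: "?I (\<lambda>u. (u $ j + s * u $ k) ^ 4) = 4 * c" if s: "s\<^sup>2 = 1" for s :: real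
    proof -
      let ?y = "axis j 1 + s *\<^sub>R axis k 1 :: real ^ 'n"
      have "?y \<bullet> ?y = 2"
        using \<open>j \<noteq> k\<close> s by (simp add: inner_add_left inner_add_right inner_axis_axis power2_eq_square)
      moreover have "norm ?y ^ 4 = ((norm ?y)\<^sup>2)\<^sup>2"
        by (simp flip: power_mult)
      ultimately have "norm ?y ^ 4 = 4"
        by (simp add: power2_norm_eq_inner)
      then show ?thesis
        using sphere_integral_inner_power[of ?y 4 i]
        by (simp add: c_def inner_add_left inner_axis')
    qed
    have int: "integrable sphere_measure (\<lambda>u. (u $ j + s * u $ k) ^ 4)"
      "integrable sphere_measure (\<lambda>u. s * (u $ j) ^ 4)" for s :: real and j k :: 'n
      by (intro integrable_sphere_measure continuous_intros)+
    have "12 * ?I (\<lambda>u. (u $ j)\<^sup>2 * (u $ k)\<^sup>2)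
        = ?I (\<lambda>u. (u $ j + 1 * u $ k) ^ 4 + (u $ j + (-1) * u $ k) ^ 4
            - 2 * (u $ j) ^ 4 - 2 * (u $ k) ^ 4)"
      unfolding Bochner_Integration.integral_mult_right_zero[symmetric]
      by (intro arg_cong[where f = "integral\<^sup>L _"] ext) (simp add: power4_eq_xxxx power2_eq_square algebra_simps)
    also have "\<dots> = ?I (\<lambda>u. (u $ j + 1 * u $ k) ^ 4) + ?I (\<lambda>u. (u $ j + (-1) * u $ k) ^ 4)
            - ?I (\<lambda>u. 2 * (u $ j) ^ 4) - ?I (\<lambda>u. 2 * (u $ k) ^ 4)"
      by (simp only: Bochner_Integration.integral_diff Bochner_Integration.integral_add
          Bochner_Integration.integrable_diff Bochner_Integration.integrable_add int)
    also have "\<dots> = 4 * c"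
      using p[of 1] p[of "-1"] by (simp add: c)
    finally show ?thesis by simp
  qed
  have int2: "integrable sphere_measure (\<lambda>u :: real ^ 'n. (u $ j)\<^sup>2 * (u $ k)\<^sup>2)" for j k :: 'n
    by (intro integrable_sphere_measure continuous_intros)
  have "1 = ?I (\<lambda>u. 1)"
    by (rule sphere_integral_const[symmetric])
  also have "\<dots> = ?I (\<lambda>u. \<Sum>j\<in>UNIV. \<Sum>k\<in>UNIV. (u $ j)\<^sup>2 * (u $ k)\<^sup>2)"
  proof (rule sphere_integral_cong)
    fix u :: "real ^ 'n" assume "norm u = 1"
    then have "(\<Sum>j\<in>UNIV. (u $ j)\<^sup>2) = 1"
      by (simp add: norm_vec_def L2_set_def)
    then show "1 = (\<Sum>j\<in>UNIV. \<Sum>k\<in>UNIV. (u $ j)\<^sup>2 * (u $ k)\<^sup>2)"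
      by (simp add: sum_product[symmetric])
  qed (intro continuous_intros)+
  also have "\<dots> = (\<Sum>j\<in>UNIV. \<Sum>k\<in>UNIV. ?I (\<lambda>u. (u $ j)\<^sup>2 * (u $ k)\<^sup>2))"
    by (simp add: Bochner_Integration.integral_sum int2)
  also have "\<dots> = (\<Sum>j\<in>(UNIV :: 'n set). \<Sum>k\<in>(UNIV :: 'n set). c / 3 + (if k = j then 2 * c / 3 else 0))"
  proof (intro sum.cong refl)
    fix j k :: 'n
    have "?I (\<lambda>u. (u $ j)\<^sup>2 * (u $ j)\<^sup>2) = c"
      using c[of j] by (simp add: power2_eq_square power4_eq_xxxx mult.assoc)
    then show "?I (\<lambda>u. (u $ j)\<^sup>2 * (u $ k)\<^sup>2) = c / 3 + (if k = j then 2 * c / 3 else 0)"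
      using mixed[of j k] by auto
  qed
  also have "\<dots> = c * real CARD('n) * (real CARD('n) + 2) / 3"
    by (simp add: sum.distrib) (simp add: field_simps)
  finally have "c * (real CARD('n) * (real CARD('n) + 2)) = 3"
    by simp
  moreover have "real CARD('n) * (real CARD('n) + 2) > 0"
    by (intro mult_pos_pos add_pos_pos) simp_all
  ultimately have "c = 3 / (real CARD('n) * (real CARD('n) + 2))"
    by (simp add: eq_divide_eq)
  then show ?thesis
    using sphere_integral_inner_power[of y 4 i] by (simp add: c_def)
qed

section \<open>Polynomials\<close>

definition monomial :: "('n::finite \<Rightarrow> nat) \<Rightarrow> real ^ 'n \<Rightarrow> real" where
  "monomial a x = (\<Prod>i\<in>UNIV. (x $ i) ^ a i)"

lemma polynomial_of_degree_le_iff: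
  "polynomial_of_degree_le t p \<longleftrightarrow>
    (\<exists>c. p = (\<lambda>x. \<Sum>a | (\<Sum>i\<in>UNIV. a i) \<le> t. c a * monomial a x))"
  by (simp add: polynomial_of_degree_le_def monomial_def)

lemma polynomial_of_degree_le_zero: "polynomial_of_degree_le t (\<lambda>x. 0)"
  unfolding polynomial_of_degree_le_def by (rule exI[of _ "\<lambda>_. 0"]) simp

lemma polynomial_of_degree_le_monomial:
  assumes "(\<Sum>i\<in>UNIV. a i) \<le> t"
  shows "polynomial_of_degree_le t (monomial a)"
  unfolding polynomial_of_degree_le_iff
proof (rule exI[of _ "\<lambda>b. if b = a then 1 else 0"], rule ext)
  fix x :: "real ^ 'a"
  show "monomial a x = (\<Sum>b | (\<Sum>i\<in>UNIV. b i) \<le> t. (if b = a then 1 else 0) * monomial b x)"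
    using assms by (simp add: if_distrib[of "\<lambda>z. z * _"] sum.delta[OF finite_exponents] cong: if_cong)
qed

lemma polynomial_of_degree_le_add:
  assumes "polynomial_of_degree_le t p" "polynomial_of_degree_le t q"
  shows "polynomial_of_degree_le t (\<lambda>x. p x + q x)"
proof -
  obtain c d where "p = (\<lambda>x. \<Sum>a | (\<Sum>i\<in>UNIV. a i) \<le> t. c a * monomial a x)"
    "q = (\<lambda>x. \<Sum>a | (\<Sum>i\<in>UNIV. a i) \<le> t. d a * monomial a x)"
    using assms unfolding polynomial_of_degree_le_iff by blast
  then show ?thesis
    unfolding polynomial_of_degree_le_iff
    by (intro exI[of _ "\<lambda>a. c a + d a"]) (simp add: sum.distrib distrib_right)
qed

lemma polynomial_of_degree_le_cmult:
  assumes "polynomial_of_degree_le t p"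
  shows "polynomial_of_degree_le t (\<lambda>x. r * p x)"
proof -
  obtain c where "p = (\<lambda>x. \<Sum>a | (\<Sum>i\<in>UNIV. a i) \<le> t. c a * monomial a x)"
    using assms unfolding polynomial_of_degree_le_iff by blast
  then show ?thesis
    unfolding polynomial_of_degree_le_iff
    by (intro exI[of _ "\<lambda>a. r * c a"]) (simp add: sum_distrib_left mult.assoc)
qed

lemma polynomial_of_degree_le_sum:
  assumes "\<And>i. i \<in> I \<Longrightarrow> polynomial_of_degree_le t (p i)"
  shows "polynomial_of_degree_le t (\<lambda>x. \<Sum>i\<in>I. p i x)"
  using assms
  by (induction I rule: infinite_finite_induct)
     (simp_all add: polynomial_of_degree_le_zero polynomial_of_degree_le_add)

lemma monomial_upd_Suc: "monomial (a(i := Suc (a i))) x = x $ i * monomial a x"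
proof -
  have "monomial (a(i := Suc (a i))) x
      = (x $ i) ^ Suc (a i) * (\<Prod>j\<in>UNIV - {i}. (x $ j) ^ (a(i := Suc (a i))) j)"
    unfolding monomial_def by (subst prod.remove[of _ i]) auto
  also have "(\<Prod>j\<in>UNIV - {i}. (x $ j) ^ (a(i := Suc (a i))) j) = (\<Prod>j\<in>UNIV - {i}. (x $ j) ^ a j)"
    by (intro prod.cong) auto
  also have "(x $ i) ^ Suc (a i) * \<dots> = x $ i * monomial a x"
    unfolding monomial_def by (subst (2) prod.remove[of _ i]) auto
  finally show ?thesis .
qed

lemma sum_upd_Suc:
  fixes a :: "'n::finite \<Rightarrow> nat"
  shows "(\<Sum>j\<in>UNIV. (a(i := Suc (a i))) j) = Suc (\<Sum>j\<in>UNIV. a j)"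
proof -
  have "(\<Sum>j\<in>UNIV. (a(i := Suc (a i))) j) = (\<Sum>j\<in>UNIV. a j + (if j = i then 1 else 0))"
    by (intro sum.cong) auto
  then show ?thesis
    by (simp add: sum.distrib)
qed

lemma polynomial_of_degree_le_mult_inner:
  fixes p :: "real ^ 'n::finite \<Rightarrow> real"
  assumes "polynomial_of_degree_le t p"
  shows "polynomial_of_degree_le (Suc t) (\<lambda>x. (y \<bullet> x) * p x)"
proof -
  obtain c where p: "p = (\<lambda>x. \<Sum>a | (\<Sum>i\<in>UNIV. a i) \<le> t. c a * monomial a x)"
    using assms unfolding polynomial_of_degree_le_iff by blast
  have eq: "(\<lambda>x. (y \<bullet> x) * p x) =
      (\<lambda>x. \<Sum>i\<in>UNIV. \<Sum>a | (\<Sum>i\<in>UNIV. a i) \<le> t. (y $ i * c a) * monomial (a(i := Suc (a i))) x)"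
    by (simp add: p inner_vec_def sum_product monomial_upd_Suc mult.assoc mult.left_commute)
  show ?thesis
    unfolding eq
    by (intro polynomial_of_degree_le_sum polynomial_of_degree_le_cmult
        polynomial_of_degree_le_monomial) (simp only: sum_upd_Suc mem_Collect_eq Suc_le_mono)
qed

lemma polynomial_of_degree_le_const: "polynomial_of_degree_le t (\<lambda>x. c)"
  using polynomial_of_degree_le_cmult[OF polynomial_of_degree_le_monomial[of "\<lambda>_. 0" t], of c]
  by (simp add: monomial_def)

lemma polynomial_of_degree_le_mono:
  assumes "polynomial_of_degree_le s p" "s \<le> t"
  shows "polynomial_of_degree_le t p"
proof -
  obtain c where "p = (\<lambda>x. \<Sum>a | (\<Sum>i\<in>UNIV. a i) \<le> s. c a * monomial a x)"
    using assms(1) unfolding polynomial_of_degree_le_iff by blast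
  then show ?thesis
    using assms(2)
    by (auto intro!: polynomial_of_degree_le_sum polynomial_of_degree_le_cmult
        polynomial_of_degree_le_monomial)
qed

lemma polynomial_of_degree_le_inner_power:
  assumes "k \<le> t"
  shows "polynomial_of_degree_le t (\<lambda>x :: real ^ 'n::finite. (y \<bullet> x) ^ k)"
proof (rule polynomial_of_degree_le_mono[OF _ assms])
  show "polynomial_of_degree_le k (\<lambda>x :: real ^ 'n. (y \<bullet> x) ^ k)"
    by (induction k) (simp_all add: polynomial_of_degree_le_const polynomial_of_degree_le_mult_inner)
qed

text \<open>A monomial of small degree becomes an explicit product of coordinates, to which the tensor
  argument for degree 4 applies.\<close>

lemma monomial_as_prod_list:
  fixes a :: "'n::finite \<Rightarrow> nat"
  assumes "(\<Sum>i\<in>UNIV. a i) = d"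
  shows "\<exists>is. length is = d \<and> (\<forall>x. monomial a x = (\<Prod>i\<leftarrow>is. x $ i))"
  using assms
proof (induction d arbitrary: a)
  case 0
  then have "a = (\<lambda>_. 0)" by auto
  then show ?case by (simp add: monomial_def)
next
  case (Suc d)
  then obtain i where "a i \<noteq> 0"
    by (metis Zero_not_Suc sum.neutral)
  define b where "b = a(i := a i - 1)"
  have a: "a = b(i := Suc (b i))"
    using \<open>a i \<noteq> 0\<close> by (auto simp: b_def)
  have "(\<Sum>i\<in>UNIV. b i) = d"
    using Suc.prems unfolding a sum_upd_Suc by simp
  from Suc.IH[OF this] obtain js where js: "length js = d" "\<And>x. monomial b x = (\<Prod>i\<leftarrow>js. x $ i)"
    by blast
  have "monomial a x = (\<Prod>i\<leftarrow>i # js. x $ i)" for x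
    unfolding a monomial_upd_Suc using js(2) by simp
  then show ?case
    using js(1) by (metis length_Cons)
qed

section \<open>Spherical designs via moments\<close>

lemma continuous_on_monomial: "continuous_on UNIV (monomial a)"
  unfolding monomial_def by (intro continuous_intros)

lemma monomial_uminus: "monomial a (- x) = (- 1) ^ (\<Sum>i\<in>UNIV. a i) * monomial a x"
proof -
  have "monomial a (- x) = (\<Prod>i\<in>UNIV. (- 1) ^ a i * (x $ i) ^ a i)"
    unfolding monomial_def by (intro prod.cong) (simp_all add: power_minus[of "_ $ _"])
  then show ?thesis
    by (simp add: monomial_def prod.distrib power_sum)
qed

text \<open>The error of the cubature formula with nodes \<open>\<Omega>\<close> and equal weights; for a
  \<open>t\<close>-design it vanishes on the monomials of degree at most \<open>t\<close>.\<close>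

definition discrepancy :: "(real ^ 'n::finite) set \<Rightarrow> (real ^ 'n \<Rightarrow> real) \<Rightarrow> real" where
  "discrepancy \<Omega> p = (LINT u|sphere_measure. p u) - (\<Sum>x\<in>\<Omega>. p x) / real (card \<Omega>)"

lemma spherical_designI:
  assumes "finite \<Omega>" "\<Omega> \<noteq> {}" "\<Omega> \<subseteq> sphere 0 1"
    and "\<And>a. (\<Sum>i\<in>UNIV. a i) \<le> t \<Longrightarrow> discrepancy \<Omega> (monomial a) = 0"
  shows "spherical_design t \<Omega>"
  unfolding spherical_design_def
proof (intro conjI allI impI)
  fix p :: "real ^ 'a \<Rightarrow> real" assume "polynomial_of_degree_le t p"
  then obtain c where p: "p = (\<lambda>x. \<Sum>a | (\<Sum>i\<in>UNIV. a i) \<le> t. c a * monomial a x)"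
    unfolding polynomial_of_degree_le_iff by blast
  have "(LINT x|sphere_measure. p x)
      = (\<Sum>a | (\<Sum>i\<in>UNIV. a i) \<le> t. c a * (LINT x|sphere_measure. monomial a x))"
    unfolding p by (subst Bochner_Integration.integral_sum)
      (auto intro!: integrable_sphere_measure continuous_intros continuous_on_monomial)
  also have "\<dots> = (\<Sum>a | (\<Sum>i\<in>UNIV. a i) \<le> t. c a * ((\<Sum>x\<in>\<Omega>. monomial a x) / real (card \<Omega>)))"
    using assms(4) by (intro sum.cong) (auto simp: discrepancy_def)
  also have "\<dots> = (\<Sum>x\<in>\<Omega>. p x) / real (card \<Omega>)"
    unfolding p sum.swap[of _ _ \<Omega>] by (simp add: sum_distrib_left sum_divide_distrib)
  finally show "(LINT x|sphere_measure. p x) = (\<Sum>x\<in>\<Omega>. p x) / real (card \<Omega>)" .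
qed (use assms in auto)

text \<open>Writing \<open>N\<close> for the number of points and \<open>c = 3 / (m (m + 2))\<close> for the mean of a fourth power, the
  discrepancies of the degree 4 monomials are the entries of the tensor
  \<open>mean (u \<otimes> u \<otimes> u \<otimes> u) - (\<Sum>x\<in>\<Omega>. x \<otimes> x \<otimes> x \<otimes> x) / N\<close>, whose squared norm is
  \<open>c - 2 * c + (\<Sum>x\<in>\<Omega>. \<Sum>y\<in>\<Omega>. (x \<bullet> y) ^ 4) / N\<^sup>2\<close>. The sum of fourth powers is thus at least \<open>c * N\<^sup>2\<close>,
  and equality makes every entry vanish.\<close>

lemma discrepancy_degree_4:
  fixes \<Omega> :: "(real ^ 'n::finite) set"
  assumes "finite \<Omega>" "\<Omega> \<noteq> {}" "\<Omega> \<subseteq> sphere 0 1"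
    and eq: "(\<Sum>x\<in>\<Omega>. \<Sum>y\<in>\<Omega>. (x \<bullet> y) ^ 4)
      = 3 * (real (card \<Omega>))\<^sup>2 / (real CARD('n) * (real CARD('n) + 2))"
  shows "discrepancy \<Omega> (\<lambda>x. x $ i * x $ j * x $ k * x $ l) = 0"
proof -
  define N where "N = real (card \<Omega>)"
  define c where "c = 3 / (real CARD('n) * (real CARD('n) + 2))"
  define Q where "Q = (UNIV :: ('n \<times> 'n \<times> 'n \<times> 'n) set)"
  define e where "e = (\<lambda>(i, j, k, l). \<lambda>x :: real ^ 'n. x $ i * x $ j * x $ k * x $ l)"
  define I where "I = (\<lambda>q. LINT u|sphere_measure. e q u)"
  have N: "N > 0"
    using assms(1,2) by (simp add: N_def card_gt_0_iff)
  have cont: "continuous_on UNIV (e q)" for q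
    unfolding e_def by (cases q) (auto intro!: continuous_intros)
  \<comment> \<open>The inner product of two fourth tensor powers.\<close>
  have contract: "(\<Sum>q\<in>Q. e q x * e q y) = (x \<bullet> y) ^ 4" for x y
  proof -
    have "(\<Sum>q\<in>Q. e q x * e q y) = (\<Sum>i\<in>UNIV. \<Sum>j\<in>UNIV. \<Sum>k\<in>UNIV. \<Sum>l\<in>UNIV.
        (x $ i * x $ j * x $ k * x $ l) * (y $ i * y $ j * y $ k * y $ l))"
      unfolding Q_def UNIV_Times_UNIV[symmetric] sum.cartesian_product
      by (intro sum.cong) (auto simp: e_def)
    also have "\<dots> = (x \<bullet> y) ^ 4"
      by (simp add: inner_vec_def power4_eq_xxxx sum_distrib_left sum_distrib_right ac_simps)
    finally show ?thesis .
  qed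
  have I_e: "(\<Sum>q\<in>Q. I q * e q x) = c * norm x ^ 4" for x
  proof -
    have "(\<Sum>q\<in>Q. I q * e q x) = (LINT u|sphere_measure. (\<Sum>q\<in>Q. e q u * e q x))"
      unfolding I_def by (subst Bochner_Integration.integral_sum)
        (auto intro!: integrable_sphere_measure continuous_intros cont)
    also have "\<dots> = (LINT u|sphere_measure. (x \<bullet> u) ^ 4)"
      by (simp add: contract inner_commute)
    finally show ?thesis
      by (simp add: sphere_integral_inner_power4 c_def)
  qed
  have I_I: "(\<Sum>q\<in>Q. I q * I q) = c"
  proof -
    have "(\<Sum>q\<in>Q. I q * I q) = (LINT u|sphere_measure. (\<Sum>q\<in>Q. I q * e q u))"
      unfolding I_def by (subst Bochner_Integration.integral_sum)
        (auto intro!: integrable_sphere_measure continuous_intros cont)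
    also have "\<dots> = (LINT u|(sphere_measure :: (real ^ 'n) measure). c)"
      unfolding I_e by (rule sphere_integral_cong) (auto intro!: continuous_intros)
    finally show ?thesis
      by (simp add: sphere_integral_const)
  qed
  have "(\<Sum>q\<in>Q. (discrepancy \<Omega> (e q))\<^sup>2)
      = (\<Sum>q\<in>Q. I q * I q - 2 / N * (\<Sum>x\<in>\<Omega>. I q * e q x) + (\<Sum>x\<in>\<Omega>. \<Sum>y\<in>\<Omega>. e q x * e q y) / N\<^sup>2)"
  proof (intro sum.cong refl)
    fix q
    define S where "S = (\<Sum>x\<in>\<Omega>. e q x)"
    have d: "discrepancy \<Omega> (e q) = I q - S / N"
      by (simp add: discrepancy_def I_def S_def N_def)
    have S: "(\<Sum>x\<in>\<Omega>. I q * e q x) = I q * S" "(\<Sum>x\<in>\<Omega>. \<Sum>y\<in>\<Omega>. e q x * e q y) = S * S"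
      unfolding S_def sum_product by (simp_all add: sum_distrib_left)
    show "(discrepancy \<Omega> (e q))\<^sup>2 = I q * I q - 2 / N * (\<Sum>x\<in>\<Omega>. I q * e q x)
        + (\<Sum>x\<in>\<Omega>. \<Sum>y\<in>\<Omega>. e q x * e q y) / N\<^sup>2"
      unfolding d S using N by (simp add: power2_eq_square field_simps)
  qed
  also have "\<dots> = (\<Sum>q\<in>Q. I q * I q) - 2 / N * (\<Sum>x\<in>\<Omega>. \<Sum>q\<in>Q. I q * e q x)
      + (\<Sum>x\<in>\<Omega>. \<Sum>y\<in>\<Omega>. \<Sum>q\<in>Q. e q x * e q y) / N\<^sup>2"
  proof -
    have "(\<Sum>q\<in>Q. \<Sum>x\<in>\<Omega>. I q * e q x) = (\<Sum>x\<in>\<Omega>. \<Sum>q\<in>Q. I q * e q x)"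
      by (rule sum.swap)
    moreover have "(\<Sum>q\<in>Q. \<Sum>x\<in>\<Omega>. \<Sum>y\<in>\<Omega>. e q x * e q y) = (\<Sum>x\<in>\<Omega>. \<Sum>y\<in>\<Omega>. \<Sum>q\<in>Q. e q x * e q y)"
      by (subst sum.swap) (intro sum.cong refl sum.swap)
    ultimately show ?thesis
      by (simp only: sum.distrib sum_subtractf sum_divide_distrib[symmetric]
          sum_distrib_left[where r = "2 / N", symmetric])
  qed
  also have "\<dots> = c - 2 / N * (N * c) + c"
  proof -
    have "(\<Sum>x\<in>\<Omega>. c * norm x ^ 4) = (\<Sum>x\<in>\<Omega>. c)"
      using assms(3) by (intro sum.cong) auto
    then show ?thesis
      using N unfolding I_I I_e contract eq by (simp add: N_def c_def)
  qed
  also have "\<dots> = 0"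
    using N by simp
  finally have "\<forall>q\<in>Q. (discrepancy \<Omega> (e q))\<^sup>2 = 0"
    by (subst (asm) sum_nonneg_eq_0_iff) (auto simp: Q_def)
  then have "discrepancy \<Omega> (e (i, j, k, l)) = 0"
    by (simp add: Q_def)
  then show ?thesis
    by (simp add: e_def)
qed

text \<open>For an antipodal set the odd degrees are automatic, and on the sphere degree 2 reduces to degree 4.\<close>

lemma spherical_design_5I:
  fixes \<Omega> :: "(real ^ 'n::finite) set"
  assumes \<Omega>: "finite \<Omega>" "\<Omega> \<noteq> {}" "\<Omega> \<subseteq> sphere 0 1" and antipodal: "\<And>x. x \<in> \<Omega> \<Longrightarrow> - x \<in> \<Omega>"
    and eq: "(\<Sum>x\<in>\<Omega>. \<Sum>y\<in>\<Omega>. (x \<bullet> y) ^ 4)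
      = 3 * (real (card \<Omega>))\<^sup>2 / (real CARD('n) * (real CARD('n) + 2))"
  shows "spherical_design 5 \<Omega>"
proof (rule spherical_designI[OF \<Omega>])
  fix a :: "'n \<Rightarrow> nat" assume a: "(\<Sum>i\<in>UNIV. a i) \<le> 5"
  let ?d = "\<Sum>i\<in>UNIV. a i"
  note deg4 = discrepancy_degree_4[OF \<Omega> eq]
  consider (odd) "odd ?d" | (0) "?d = 0" | (2) "?d = 2" | (4) "?d = 4"
  proof -
    have "?d = 0 \<or> ?d = 1 \<or> ?d = 2 \<or> ?d = 3 \<or> ?d = 4 \<or> ?d = 5"
      using a by arith
    then show ?thesis
      using that by (elim disjE) simp_all
  qed
  then show "discrepancy \<Omega> (monomial a) = 0"
  proof cases
    case odd
    have neg: "monomial a (- x) = - monomial a x" for x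
      using odd by (simp add: monomial_uminus)
    have "bij_betw uminus \<Omega> \<Omega>"
      using antipodal by (intro bij_betwI[of _ _ _ uminus]) auto
    then have "(\<Sum>x\<in>\<Omega>. monomial a x) = (\<Sum>x\<in>\<Omega>. monomial a (- x))"
      by (rule sum.reindex_bij_betw[symmetric])
    then have "(\<Sum>x\<in>\<Omega>. monomial a x) = 0"
      by (simp add: neg sum_negf)
    moreover have "(LINT u|sphere_measure. monomial a u) = 0"
      using continuous_on_monomial neg by (rule sphere_integral_odd)
    ultimately show ?thesis
      by (simp add: discrepancy_def)
  next
    case 0
    then have "a = (\<lambda>_. 0)" by auto
    then show ?thesis
      using \<Omega>(1,2) by (simp add: discrepancy_def monomial_def)
  next
    case 4
    then obtain js where "length js = 4" and js: "\<And>x. monomial a x = (\<Prod>i\<leftarrow>js. x $ i)"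
      using monomial_as_prod_list by blast
    then obtain i j k l where "js = [i, j, k, l]"
      by (auto simp: numeral_eq_Suc length_Suc_conv)
    then have "monomial a = (\<lambda>x. x $ i * x $ j * x $ k * x $ l)"
      using js by (simp add: fun_eq_iff mult.assoc)
    then show ?thesis
      using deg4 by simp
  next
    case 2
    then obtain js where "length js = 2" and js: "\<And>x. monomial a x = (\<Prod>i\<leftarrow>js. x $ i)"
      using monomial_as_prod_list by blast
    then obtain i j where "js = [i, j]"
      by (auto simp: numeral_eq_Suc length_Suc_conv)
    then have mon: "monomial a = (\<lambda>x. x $ i * x $ j)"
      using js by (simp add: fun_eq_iff)
    \<comment> \<open>On the sphere multiplication by \<open>\<Sum>k. (x $ k)\<^sup>2 = 1\<close> raises the degree to 4.\<close>
    have sphere: "x $ i * x $ j = (\<Sum>k\<in>UNIV. x $ i * x $ j * x $ k * x $ k)"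
      if "norm x = 1" for x :: "real ^ 'n"
    proof -
      have "(\<Sum>k\<in>UNIV. x $ k * x $ k) = 1"
        using that by (simp add: norm_eq_1 inner_vec_def)
      then show ?thesis
        by (simp add: sum_distrib_left[symmetric] mult.assoc)
    qed
    have "(LINT u|sphere_measure. monomial a u)
        = (LINT u|sphere_measure. (\<Sum>k\<in>UNIV. u $ i * u $ j * u $ k * u $ k))"
      unfolding mon by (rule sphere_integral_cong[OF _ _ sphere]) (auto intro!: continuous_intros)
    also have "\<dots> = (\<Sum>k\<in>UNIV. LINT u|sphere_measure. u $ i * u $ j * u $ k * u $ k)"
      by (subst Bochner_Integration.integral_sum)
        (auto intro!: integrable_sphere_measure continuous_intros)
    also have "\<dots> = (\<Sum>k\<in>UNIV. (\<Sum>x\<in>\<Omega>. x $ i * x $ j * x $ k * x $ k) / real (card \<Omega>))"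
      using deg4[of i j] by (intro sum.cong) (auto simp: discrepancy_def)
    also have "\<dots> = (\<Sum>k\<in>UNIV. \<Sum>x\<in>\<Omega>. x $ i * x $ j * x $ k * x $ k) / real (card \<Omega>)"
      by (simp add: sum_divide_distrib)
    also have "(\<Sum>k\<in>UNIV. \<Sum>x\<in>\<Omega>. x $ i * x $ j * x $ k * x $ k)
        = (\<Sum>x\<in>\<Omega>. \<Sum>k\<in>UNIV. x $ i * x $ j * x $ k * x $ k)"
      by (rule sum.swap)
    also have "(\<Sum>x\<in>\<Omega>. \<Sum>k\<in>UNIV. x $ i * x $ j * x $ k * x $ k) = (\<Sum>x\<in>\<Omega>. monomial a x)"
      unfolding mon using sphere \<Omega>(3) by (intro sum.cong) auto
    finally show ?thesis
      by (simp add: discrepancy_def)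
  qed
qed

section \<open>Tight designs and their Gram matrices\<close>

text \<open>The cosine of the angle between the \<open>m (m + 1) / 2\<close> equiangular lines spanned by a tight design.\<close>

definition angle_cos :: "nat \<Rightarrow> real" where
  "angle_cos m = 1 / sqrt (real m + 2)"

lemma angle_cos_bounds: "0 < angle_cos m" "angle_cos m < 1"
  by (simp_all add: angle_cos_def)

lemma angle_cos_square: "(angle_cos m)\<^sup>2 = 1 / (real m + 2)"
  by (simp add: angle_cos_def power_divide)

text \<open>The combinatorial data shared by designs and Taylor graphs: \<open>g\<close> stands for the Gram matrix of an antipodal
  set of unit vectors spanning equiangular lines, or for the function \<open>1, \<alpha>, - \<alpha>, -1\<close> of the distances
  \<open>0, 1, 2, 3\<close> in an antipodal double cover of a complete graph. The map \<open>\<tau>\<close> is the antipode.\<close>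

locale antipodal_gram =
  fixes \<alpha> :: real and V :: "'a set" and g :: "'a \<Rightarrow> 'a \<Rightarrow> real" and \<tau> :: "'a \<Rightarrow> 'a"
  assumes alpha: "0 < \<alpha>" "\<alpha> < 1"
    and finite_V: "finite V"
    and gram_sym: "x \<in> V \<Longrightarrow> y \<in> V \<Longrightarrow> g x y = g y x"
    and gram_values: "x \<in> V \<Longrightarrow> y \<in> V \<Longrightarrow> g x y = 1 \<or> g x y = -1 \<or> g x y = \<alpha> \<or> g x y = - \<alpha>"
    and gram_eq_1: "x \<in> V \<Longrightarrow> y \<in> V \<Longrightarrow> g x y = 1 \<longleftrightarrow> x = y"
    and antipode_in: "x \<in> V \<Longrightarrow> \<tau> x \<in> V"
    and gram_antipode_left: "x \<in> V \<Longrightarrow> y \<in> V \<Longrightarrow> g (\<tau> x) y = - g x y"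
begin

definition nbrs :: "'a \<Rightarrow> 'a set" where
  "nbrs y = {z \<in> V. g y z = \<alpha>}"

lemma gram_antipode_right: "x \<in> V \<Longrightarrow> y \<in> V \<Longrightarrow> g x (\<tau> y) = - g x y"
  by (metis antipode_in gram_antipode_left gram_sym)

lemma gram_self: "x \<in> V \<Longrightarrow> g x x = 1"
  by (simp add: gram_eq_1)

lemma gram_eq_minus_1: "x \<in> V \<Longrightarrow> y \<in> V \<Longrightarrow> g x y = -1 \<longleftrightarrow> y = \<tau> x"
  by (metis antipode_in gram_antipode_left gram_eq_1 minus_equation_iff)

lemma antipode_antipode: "x \<in> V \<Longrightarrow> \<tau> (\<tau> x) = x"
  by (metis antipode_in gram_antipode_left gram_eq_minus_1 gram_self)

lemma antipode_neq: "x \<in> V \<Longrightarrow> \<tau> x \<noteq> x"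
  by (metis antipode_in gram_antipode_left gram_self one_neq_neg_one)

lemma nbrs_subset: "nbrs y \<subseteq> V" and finite_nbrs: "finite (nbrs y)"
  using finite_V by (auto simp: nbrs_def)

text \<open>Up to the antipodal pair of \<open>y\<close> itself, every antipodal pair has exactly one member
  adjacent to \<open>y\<close>.\<close>

lemma sum_split_at:
  fixes F :: "'a \<Rightarrow> real"
  assumes y: "y \<in> V"
  shows "(\<Sum>z\<in>V. F z) = F y + F (\<tau> y) + (\<Sum>z\<in>nbrs y. F z + F (\<tau> z))"
proof -
  have inj: "inj_on \<tau> (nbrs y)"
    by (rule inj_onI) (metis antipode_antipode nbrs_subset subsetD)
  have V: "V = insert y (insert (\<tau> y) (nbrs y \<union> \<tau> ` nbrs y))"
  proof (intro set_eqI iffI)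
    fix z assume z: "z \<in> V"
    consider "g y z = 1" | "g y z = -1" | "g y z = \<alpha>" | "g y z = - \<alpha>"
      using gram_values[OF y z] by blast
    then show "z \<in> insert y (insert (\<tau> y) (nbrs y \<union> \<tau> ` nbrs y))"
    proof cases
      case 4
      then have "\<tau> z \<in> nbrs y"
        using y z by (simp add: nbrs_def antipode_in gram_antipode_right)
      then have "\<tau> (\<tau> z) \<in> \<tau> ` nbrs y" by (rule imageI)
      then show ?thesis
        using z by (simp add: antipode_antipode)
    qed (use y z in \<open>auto simp: gram_eq_1 gram_eq_minus_1 nbrs_def\<close>)
  qed (use y antipode_in nbrs_subset in auto)
  have in_tau: "g y z = - \<alpha>" if "z \<in> \<tau> ` nbrs y" for z
    using that y by (auto simp: nbrs_def gram_antipode_right)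
  have "g y z \<noteq> - \<alpha>" if "z \<in> nbrs y" for z
    using that alpha by (simp add: nbrs_def)
  then have disj: "nbrs y \<inter> \<tau> ` nbrs y = {}"
    using in_tau by blast
  have "\<tau> y \<notin> nbrs y \<union> \<tau> ` nbrs y" "y \<notin> insert (\<tau> y) (nbrs y \<union> \<tau> ` nbrs y)"
    using in_tau[of y] in_tau[of "\<tau> y"] alpha y antipode_neq[OF y]
    by (auto simp: nbrs_def gram_antipode_right gram_self)
  then have "(\<Sum>z\<in>V. F z) = F y + (F (\<tau> y) + ((\<Sum>z\<in>nbrs y. F z) + (\<Sum>z\<in>\<tau> ` nbrs y. F z)))"
    by (subst V) (simp add: finite_nbrs disj sum.union_disjoint)
  then show ?thesis
    by (simp add: sum.reindex[OF inj] sum.distrib)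
qed

lemma card_V_nbrs: "y \<in> V \<Longrightarrow> card V = 2 + 2 * card (nbrs y)"
  using sum_split_at[of y "\<lambda>_. 1"] by simp

text \<open>An entry of the square of the Gram matrix is, up to a known term, a sum over the neighbours of a
  single vertex. This translates between the matrix equation and intersection numbers.\<close>

lemma gram_square_nbrs:
  assumes "x \<in> V" "y \<in> V"
  shows "(\<Sum>z\<in>V. g x z * g z y) = 2 * g x y + 2 * \<alpha> * (\<Sum>z\<in>nbrs y. g x z)"
proof -
  have "(\<Sum>z\<in>V. g x z * g z y) = 2 * g x y + (\<Sum>z\<in>nbrs y. 2 * \<alpha> * g x z)"
    unfolding sum_split_at[OF assms(2)]
  proof (intro arg_cong2[where f = "(+)"] sum.cong refl)
    fix z assume "z \<in> nbrs y"
    then have z: "z \<in> V" "g z y = \<alpha>"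
      using assms by (simp_all add: nbrs_def gram_sym)
    then show "g x z * g z y + g x (\<tau> z) * g (\<tau> z) y = 2 * \<alpha> * g x z"
      using assms by (simp add: gram_antipode_left gram_antipode_right)
  qed (use assms in \<open>simp add: gram_self gram_antipode_left gram_antipode_right antipode_in\<close>)
  then show ?thesis
    by (simp add: sum_distrib_left)
qed

text \<open>Splitting the neighbours of \<open>y\<close> according to their relation to a vertex \<open>x\<close> adjacent to \<open>y\<close>:
  one of them is \<open>x\<close> itself, and none is antipodal to \<open>x\<close>.\<close>

lemma nbrs_split:
  fixes F :: "real \<Rightarrow> real"
  assumes xy: "x \<in> V" "y \<in> V" "g x y = \<alpha>"
  shows "(\<Sum>z\<in>nbrs y. F (g x z)) = F 1 + F \<alpha> * card {z \<in> nbrs y. g x z = \<alpha>}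
    + F (- \<alpha>) * card {z \<in> nbrs y. g x z = - \<alpha>}"
proof -
  have eq: "nbrs y = insert x ({z \<in> nbrs y. g x z = \<alpha>} \<union> {z \<in> nbrs y. g x z = - \<alpha>})" (is "_ = insert x (?P \<union> ?Q)")
  proof (intro set_eqI iffI)
    fix z assume z: "z \<in> nbrs y"
    then have zV: "z \<in> V" and yz: "g y z = \<alpha>" by (simp_all add: nbrs_def)
    have "g x z \<noteq> -1"
    proof
      assume "g x z = -1"
      then have "z = \<tau> x" using gram_eq_minus_1 xy zV by simp
      then have "g y z = - \<alpha>" using xy by (simp add: gram_antipode_right gram_sym)
      with yz alpha show False by simp
    qed
    then show "z \<in> insert x (?P \<union> ?Q)"
      using gram_values[OF xy(1) zV] gram_eq_1[OF xy(1) zV] z by auto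
  next
    fix z assume "z \<in> insert x (?P \<union> ?Q)"
    then show "z \<in> nbrs y"
      using xy by (auto simp: nbrs_def gram_sym)
  qed
  have "x \<notin> ?P \<union> ?Q" "?P \<inter> ?Q = {}"
    using alpha xy by (auto simp: gram_self)
  then have "(\<Sum>z\<in>nbrs y. F (g x z)) = F (g x x) + ((\<Sum>z\<in>?P. F (g x z)) + (\<Sum>z\<in>?Q. F (g x z)))"
    by (subst eq) (simp add: finite_nbrs sum.union_disjoint)
  then show ?thesis
    using xy by (simp add: gram_self)
qed

lemma card_nbrs_split:
  assumes "x \<in> V" "y \<in> V" "g x y = \<alpha>"
  shows "card (nbrs y) = 1 + card {z \<in> nbrs y. g x z = \<alpha>} + card {z \<in> nbrs y. g x z = - \<alpha>}"
  using nbrs_split[OF assms, of "\<lambda>_. 1"] by simp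

lemma sum_nbrs_split:
  assumes "x \<in> V" "y \<in> V" "g x y = \<alpha>"
  shows "(\<Sum>z\<in>nbrs y. g x z)
    = 1 + \<alpha> * (real (card {z \<in> nbrs y. g x z = \<alpha>}) - real (card {z \<in> nbrs y. g x z = - \<alpha>}))"
  using nbrs_split[OF assms, of "\<lambda>t. t"] by (simp add: algebra_simps)

end

text \<open>The equation \<open>gram_square\<close> says that the Gram matrix divided by \<open>m + 1\<close> is a projection. For designs
  it is the second moment condition; for graphs it encodes the intersection array.\<close>

locale taylor_gram = antipodal_gram "angle_cos m" V g \<tau>
  for m :: nat and V :: "'a set" and g \<tau> +
  assumes m_ge_3: "m \<ge> 3"
    and card_V: "card V = m * (m + 1)"
    and gram_square: "x \<in> V \<Longrightarrow> y \<in> V \<Longrightarrow> (\<Sum>z\<in>V. g x z * g z y) = (real m + 1) * g x y"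

lemma taylor_gram_pullback:
  assumes "taylor_gram m V g \<tau>" and h: "bij_betw h W V"
  shows "taylor_gram m W (\<lambda>x y. g (h x) (h y)) (\<lambda>x. inv_into W h (\<tau> (h x)))"
proof -
  interpret taylor_gram m V g \<tau> by fact
  have hV: "h x \<in> V" if "x \<in> W" for x
    using that h by (auto simp: bij_betw_def)
  have hinv: "h (inv_into W h v) = v" "inv_into W h v \<in> W" if "v \<in> V" for v
    using that h by (auto simp: bij_betw_def f_inv_into_f inv_into_into)
  show ?thesis
  proof
    show "finite W" using h finite_V by (simp add: bij_betw_finite)
    show "card W = m * (m + 1)" using h card_V by (simp add: bij_betw_same_card)
    show "(\<Sum>z\<in>W. g (h x) (h z) * g (h z) (h y)) = (real m + 1) * g (h x) (h y)"
      if "x \<in> W" "y \<in> W" for x y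
      using sum.reindex_bij_betw[OF h, of "\<lambda>z. g (h x) z * g z (h y)"] that
      by (simp add: gram_square hV)
    show "g (h x) (h y) = 1 \<longleftrightarrow> x = y" if "x \<in> W" "y \<in> W" for x y
      using that h by (simp add: gram_eq_1 hV) (auto simp: bij_betw_def inj_on_def)
    show "g (h x) (h y) = 1 \<or> g (h x) (h y) = -1 \<or> g (h x) (h y) = angle_cos m
        \<or> g (h x) (h y) = - angle_cos m" if "x \<in> W" "y \<in> W" for x y
      using that by (intro gram_values hV)
  qed (use alpha m_ge_3 in \<open>auto simp: hV hinv antipode_in gram_antipode_left intro: gram_sym\<close>)
qed

lemma tight_spherical_5_design_card:
  fixes \<Omega> :: "(real ^ 'n::finite) set"
  assumes "tight_spherical_5_design \<Omega>"
  shows "card \<Omega> = CARD('n) * (CARD('n) + 1)"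
  using assms by (simp add: tight_spherical_5_design_def choose_two)

lemma spherical_design_sum_power:
  fixes \<Omega> :: "(real ^ 'n::finite) set"
  assumes "spherical_design t \<Omega>" "k \<le> t"
  shows "(\<Sum>z\<in>\<Omega>. (y \<bullet> z) ^ k) = real (card \<Omega>) * (LINT u|sphere_measure. (y \<bullet> u) ^ k)"
proof -
  have "card \<Omega> > 0"
    using assms(1) by (simp add: spherical_design_def card_gt_0_iff)
  moreover have "(LINT u|sphere_measure. (y \<bullet> u) ^ k) = (\<Sum>z\<in>\<Omega>. (y \<bullet> z) ^ k) / real (card \<Omega>)"
    using assms(1) polynomial_of_degree_le_inner_power[OF assms(2), of y]
    unfolding spherical_design_def by blast
  ultimately show ?thesis by simp
qed

lemma spherical_design_sum_odd_power:
  fixes \<Omega> :: "(real ^ 'n::finite) set"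
  assumes "spherical_design t \<Omega>" "k \<le> t" "odd k"
  shows "(\<Sum>z\<in>\<Omega>. (y \<bullet> z) ^ k) = 0"
proof -
  have "(LINT u|sphere_measure. (y \<bullet> u) ^ k) = 0"
    using \<open>odd k\<close> by (intro sphere_integral_odd) (auto intro!: continuous_intros)
  then show ?thesis
    by (simp add: spherical_design_sum_power[OF assms(1,2)])
qed

text \<open>The linear programming bound of Delsarte, Goethals and Seidel, with \<open>a = 1 / (m + 2)\<close>. The polynomial
  \<open>f t = (1 + t) * (t\<^sup>2 - a)\<^sup>2\<close> has degree 5 and is nonnegative on \<open>[-1, 1]\<close>. Its sum over the design, taken
  at the inner products with \<open>x\<close>, is known from the moments; for \<open>m (m + 1)\<close> points it
  equals \<open>f 1\<close>, the contribution of \<open>x\<close> alone. Hence \<open>f\<close> vanishes at all other inner products.\<close>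

lemma tight_spherical_5_design_inner:
  fixes \<Omega> :: "(real ^ 'n::finite) set"
  assumes \<Omega>: "tight_spherical_5_design \<Omega>" and x: "x \<in> \<Omega>" and y: "y \<in> \<Omega>" "y \<noteq> x"
  shows "x \<bullet> y = -1 \<or> (x \<bullet> y)\<^sup>2 = 1 / (real CARD('n) + 2)"
proof -
  define m where "m = real CARD('n)"
  define a where "a = 1 / (m + 2)"
  define f where "f = (\<lambda>t :: real. (1 + t) * (t\<^sup>2 - a)\<^sup>2)"
  have m: "m > 0" by (simp add: m_def)
  have design: "spherical_design 5 \<Omega>"
    using \<Omega> by (simp add: tight_spherical_5_design_def)
  then have fin: "finite \<Omega>" and norm: "\<And>z. z \<in> \<Omega> \<Longrightarrow> norm z = 1"
    by (auto simp: spherical_design_def)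
  have N: "real (card \<Omega>) = m * (m + 1)"
    by (simp add: tight_spherical_5_design_card[OF \<Omega>] m_def algebra_simps)
  have f_nonneg: "f (x \<bullet> z) \<ge> 0" if "z \<in> \<Omega>" for z
  proof -
    have "\<bar>x \<bullet> z\<bar> \<le> 1"
      using Cauchy_Schwarz_ineq2[of x z] norm[OF x] norm[OF that] by simp
    then show ?thesis
      by (simp add: f_def)
  qed
  have "(\<Sum>z\<in>\<Omega>. f (x \<bullet> z)) = (\<Sum>z\<in>\<Omega>. (x \<bullet> z) ^ 4 + (x \<bullet> z) ^ 5 - 2 * a * (x \<bullet> z)\<^sup>2
      - 2 * a * (x \<bullet> z) ^ 3 + a\<^sup>2 * (x \<bullet> z) ^ 1 + a\<^sup>2)"
    by (intro sum.cong refl) (simp add: f_def algebra_simps power2_eq_square power3_eq_cube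
        power4_eq_xxxx numeral_eq_Suc)
  also have "\<dots> = (\<Sum>z\<in>\<Omega>. (x \<bullet> z) ^ 4) - 2 * a * (\<Sum>z\<in>\<Omega>. (x \<bullet> z)\<^sup>2) + real (card \<Omega>) * a\<^sup>2"
    using spherical_design_sum_odd_power[OF design, of 1 x] spherical_design_sum_odd_power[OF design, of 3 x]
      spherical_design_sum_odd_power[OF design, of 5 x]
    by (simp add: sum.distrib sum_subtractf sum_distrib_left[symmetric])
  also have "\<dots> = m * (m + 1) * (3 / (m * (m + 2)) - 2 * a * (1 / m) + a\<^sup>2)"
  proof -
    have "(\<Sum>z\<in>\<Omega>. (x \<bullet> z)\<^sup>2) = m * (m + 1) * (1 / m)"
      using norm[OF x] by (simp only: spherical_design_sum_power[OF design]
          sphere_integral_inner_power2 N m_def[symmetric]) simp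
    moreover have "(\<Sum>z\<in>\<Omega>. (x \<bullet> z) ^ 4) = m * (m + 1) * (3 / (m * (m + 2)))"
      using norm[OF x] by (simp only: spherical_design_sum_power[OF design]
          sphere_integral_inner_power4 N m_def[symmetric]) simp
    ultimately show ?thesis
      unfolding N by algebra
  qed
  also have "\<dots> = 2 * (1 - a)\<^sup>2"
  proof -
    have "a * (m + 2) = 1" using m by (simp add: a_def)
    have "3 / (m * (m + 2)) = 3 * a / m" by (simp add: a_def)
    then have "m * (m + 1) * (3 / (m * (m + 2)) - 2 * a * (1 / m) + a\<^sup>2) = (m + 1) * (a + m * a\<^sup>2)"
      using m by (simp add: field_simps)
    also have "\<dots> = 2 * (1 - a)\<^sup>2"
      using m by (simp add: a_def power2_eq_square divide_simps) (simp add: algebra_simps)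
    finally show ?thesis .
  qed
  also have "\<dots> = f (x \<bullet> x)"
    using norm[OF x] by (simp add: f_def norm_eq_1)
  finally have "(\<Sum>z\<in>\<Omega> - {x}. f (x \<bullet> z)) = 0"
    using sum.remove[OF fin x, of "\<lambda>z. f (x \<bullet> z)"] by simp
  then have "f (x \<bullet> y) = 0"
    using y fin f_nonneg by (subst (asm) sum_nonneg_eq_0_iff) auto
  then show ?thesis
    by (auto simp: f_def a_def m_def)
qed

text \<open>If \<open>- x\<close> were missing, all other inner products with \<open>x\<close> would have the same square \<open>a < 1\<close>, so the third
  moment \<open>1 + a * S = 0\<close> would contradict the first moment \<open>1 + S = 0\<close>, with \<open>S\<close> the sum of
  these inner products.\<close>

lemma tight_spherical_5_design_antipodal:
  fixes \<Omega> :: "(real ^ 'n::finite) set"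
  assumes \<Omega>: "tight_spherical_5_design \<Omega>" and x: "x \<in> \<Omega>"
  shows "- x \<in> \<Omega>"
proof (rule ccontr)
  assume neg: "- x \<notin> \<Omega>"
  define a where "a = 1 / (real CARD('n) + 2)"
  have design: "spherical_design 5 \<Omega>"
    using \<Omega> by (simp add: tight_spherical_5_design_def)
  then have fin: "finite \<Omega>" and norm: "\<And>z. z \<in> \<Omega> \<Longrightarrow> norm z = 1"
    by (auto simp: spherical_design_def)
  have sq: "(x \<bullet> z)\<^sup>2 = a" if z: "z \<in> \<Omega> - {x}" for z
  proof -
    have "x \<bullet> z \<noteq> -1"
    proof
      assume "x \<bullet> z = -1"
      then have "(x + z) \<bullet> (x + z) = 0"
        using norm[OF x] norm[of z] z by (simp add: inner_add_left inner_add_right inner_commute norm_eq_1)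
      then have "z = - x"
        by (simp add: eq_neg_iff_add_eq_0 add.commute)
      with z neg show False by simp
    qed
    then show ?thesis
      using tight_spherical_5_design_inner[OF \<Omega> x, of z] z by (auto simp: a_def)
  qed
  have "(\<Sum>z\<in>\<Omega> - {x}. (x \<bullet> z) ^ 3) = (\<Sum>z\<in>\<Omega> - {x}. a * (x \<bullet> z))"
    by (intro sum.cong refl) (simp add: power3_eq_cube sq[symmetric] power2_eq_square)
  then have "1 + a * (\<Sum>z\<in>\<Omega> - {x}. x \<bullet> z) = 0"
    using spherical_design_sum_odd_power[OF design, of 3 x] norm[OF x]
      sum.remove[OF fin x, of "\<lambda>z. (x \<bullet> z) ^ 3"] by (simp add: norm_eq_1 sum_distrib_left)
  moreover have "(\<Sum>z\<in>\<Omega> - {x}. x \<bullet> z) = -1"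
    using spherical_design_sum_odd_power[OF design, of 1 x] norm[OF x]
      sum.remove[OF fin x, of "\<lambda>z. x \<bullet> z"] by (simp add: norm_eq_1)
  ultimately show False
    by (simp add: a_def)
qed

text \<open>The second moment condition, polarized: a design is a tight frame.\<close>

lemma tight_spherical_5_design_frame:
  fixes \<Omega> :: "(real ^ 'n::finite) set"
  assumes \<Omega>: "tight_spherical_5_design \<Omega>"
  shows "(\<Sum>z\<in>\<Omega>. (x \<bullet> z) * (z \<bullet> y)) = (real CARD('n) + 1) * (x \<bullet> y)"
proof -
  have design: "spherical_design 5 \<Omega>"
    using \<Omega> by (simp add: tight_spherical_5_design_def)
  have sq: "(\<Sum>z\<in>\<Omega>. (w \<bullet> z)\<^sup>2) = (real CARD('n) + 1) * (w \<bullet> w)" for w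
  proof -
    have "real (card \<Omega>) = real CARD('n) * (real CARD('n) + 1)"
      by (simp add: tight_spherical_5_design_card[OF \<Omega>] algebra_simps)
    then show ?thesis
      using spherical_design_sum_power[OF design, of 2 w]
      by (simp only: sphere_integral_inner_power2 power2_norm_eq_inner) simp
  qed
  have "(\<Sum>z\<in>\<Omega>. (x \<bullet> z) * (z \<bullet> y)) = (\<Sum>z\<in>\<Omega>. (((x + y) \<bullet> z)\<^sup>2 - ((x - y) \<bullet> z)\<^sup>2) / 4)"
    by (intro sum.cong refl)
       (simp add: inner_add_left inner_diff_left inner_commute[of _ y] power2_eq_square algebra_simps)
  also have "\<dots> = ((\<Sum>z\<in>\<Omega>. ((x + y) \<bullet> z)\<^sup>2) - (\<Sum>z\<in>\<Omega>. ((x - y) \<bullet> z)\<^sup>2)) / 4"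
    by (simp add: sum_divide_distrib[symmetric] sum_subtractf)
  also have "\<dots> = (real CARD('n) + 1) * (x \<bullet> y)"
    unfolding sq by (simp add: inner_add_left inner_add_right inner_diff_left inner_diff_right
        inner_commute[of y x] field_simps)
  finally show ?thesis .
qed

lemma tight_spherical_5_design_imp_gram:
  fixes \<Omega> :: "(real ^ 'n::finite) set"
  assumes \<Omega>: "tight_spherical_5_design \<Omega>" and m: "CARD('n) \<ge> 3"
  shows "taylor_gram CARD('n) \<Omega> (\<bullet>) uminus"
proof
  have design: "spherical_design 5 \<Omega>"
    using \<Omega> by (simp add: tight_spherical_5_design_def)
  then have norm: "norm z = 1" if "z \<in> \<Omega>" for z
    using that by (auto simp: spherical_design_def)
  show "finite \<Omega>"
    using design by (simp add: spherical_design_def)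
  have vals: "x \<bullet> y = -1 \<or> x \<bullet> y = angle_cos CARD('n) \<or> x \<bullet> y = - angle_cos CARD('n)"
    if "x \<in> \<Omega>" "y \<in> \<Omega>" "y \<noteq> x" for x y
    using tight_spherical_5_design_inner[OF \<Omega> that]
    by (auto simp: angle_cos_square[symmetric] power2_eq_iff)
  fix x y assume xy: "x \<in> \<Omega>" "y \<in> \<Omega>"
  show "x \<bullet> y = 1 \<longleftrightarrow> x = y"
    using vals[OF xy] norm[OF xy(1)] angle_cos_bounds[of "CARD('n)"]
    by (cases "y = x") (auto simp: norm_eq_1)
  show "x \<bullet> y = 1 \<or> x \<bullet> y = -1 \<or> x \<bullet> y = angle_cos CARD('n) \<or> x \<bullet> y = - angle_cos CARD('n)"
    using vals[OF xy] norm[OF xy(1)] by (auto simp: norm_eq_1)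
qed (use tight_spherical_5_design_frame[OF \<Omega>] tight_spherical_5_design_card[OF \<Omega>]
    tight_spherical_5_design_antipodal[OF \<Omega>] angle_cos_bounds m in \<open>auto simp: inner_commute\<close>)

text \<open>Every row of the Gram matrix consists of one entry \<open>1\<close>, one entry \<open>-1\<close> and entries \<open>\<plusminus>angle_cos m\<close>.
  With \<open>m (m + 1)\<close> rows this is equality in the fourth moment inequality.\<close>

lemma gram_imp_tight_spherical_5_design:
  fixes \<Omega> :: "(real ^ 'n::finite) set"
  assumes "taylor_gram CARD('n) \<Omega> (\<bullet>) \<tau>"
  shows "tight_spherical_5_design \<Omega>"
proof -
  define m where "m = CARD('n)"
  interpret taylor_gram m \<Omega> "(\<bullet>)" \<tau>
    using assms by (simp add: m_def)
  have norm: "norm x = 1" if "x \<in> \<Omega>" for x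
    using gram_self[OF that] by (simp add: norm_eq_1)
  have neg: "- x \<in> \<Omega>" if x: "x \<in> \<Omega>" for x
  proof -
    have "(x + \<tau> x) \<bullet> (x + \<tau> x) = 0"
      using x by (simp add: inner_add_left inner_add_right gram_antipode_left gram_antipode_right
          gram_self antipode_in)
    then have "- x = \<tau> x"
      by (metis add.inverse_unique inner_eq_zero_iff)
    then show ?thesis
      using antipode_in[OF x] by simp
  qed
  define N where "N = real (card \<Omega>)"
  have N: "N = real m * (real m + 1)"
    by (simp add: N_def card_V algebra_simps)
  have row: "(\<Sum>y\<in>\<Omega>. (x \<bullet> y) ^ 4) = 3 * (real m + 1) / (real m + 2)" if x: "x \<in> \<Omega>" for x
  proof -
    have "(\<Sum>y\<in>\<Omega>. (x \<bullet> y) ^ 4) = 2 + (\<Sum>z\<in>nbrs x. 2 * (angle_cos m) ^ 4)"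
      unfolding sum_split_at[OF x]
    proof (intro arg_cong2[where f = "(+)"] sum.cong refl)
      fix z assume "z \<in> nbrs x"
      then show "(x \<bullet> z) ^ 4 + (x \<bullet> \<tau> z) ^ 4 = 2 * (angle_cos m) ^ 4"
        using x by (simp add: nbrs_def gram_antipode_right)
    qed (use x in \<open>simp add: gram_self gram_antipode_right\<close>)
    also have "\<dots> = 2 + (N - 2) * (1 / (real m + 2))\<^sup>2"
    proof -
      have "(angle_cos m) ^ 4 = (1 / (real m + 2))\<^sup>2"
        unfolding angle_cos_square[symmetric] by (simp flip: power_mult)
      moreover have "2 * real (card (nbrs x)) = N - 2"
        using card_V_nbrs[OF x] by (simp add: N_def)
      ultimately show ?thesis by simp
    qed
    also have "\<dots> = 3 * (real m + 1) / (real m + 2)"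
      unfolding N by (simp add: power2_eq_square divide_simps) (simp add: algebra_simps)
    finally show ?thesis .
  qed
  have "\<Omega> \<noteq> {}"
    using card_V m_ge_3 by auto
  have "spherical_design 5 \<Omega>"
  proof (rule spherical_design_5I)
    show "(\<Sum>x\<in>\<Omega>. \<Sum>y\<in>\<Omega>. (x \<bullet> y) ^ 4)
        = 3 * (real (card \<Omega>))\<^sup>2 / (real CARD('n) * (real CARD('n) + 2))"
    proof -
      have "real m > 0" "real m + 2 > 0"
        using m_ge_3 by simp_all
      then have "N * (3 * (real m + 1) / (real m + 2)) = 3 * N\<^sup>2 / (real m * (real m + 2))"
        unfolding N by (simp add: power2_eq_square divide_simps) (simp add: algebra_simps)?
      then show ?thesis
        by (simp add: row N_def[symmetric] m_def[symmetric])
    qed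
  qed (use finite_V norm neg \<open>\<Omega> \<noteq> {}\<close> in auto)
  then show ?thesis
    using card_V by (simp add: tight_spherical_5_design_def choose_two m_def)
qed

section \<open>Distances in graphs\<close>

context pair_graph
begin

lemma vwalk_iff_relpow:
  "(\<exists>p. vwalk p (with_proj G) \<and> hd p = x \<and> last p = y \<and> vwalk_length p = n)
    \<longleftrightarrow> x \<in> pverts G \<and> (x, y) \<in> parcs G ^^ n"
proof (induction n arbitrary: x)
  case 0
  have "vwalk p (with_proj G) \<and> hd p = x \<and> last p = y \<and> vwalk_length p = 0
      \<longleftrightarrow> p = [x] \<and> x = y \<and> x \<in> pverts G" for p
    by (cases p) (auto simp: vwalk_def)
  then show ?case by auto
next
  case (Suc n)
  show ?case
  proof
    assume "\<exists>p. vwalk p (with_proj G) \<and> hd p = x \<and> last p = y \<and> vwalk_length p = Suc n"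
    then obtain p where p: "vwalk p (with_proj G)" "hd p = x" "last p = y" "length p = Suc (Suc n)"
      by auto
    then obtain z q where q: "p = x # z # q"
      by (auto simp: length_Suc_conv)
    with p have "(x, z) \<in> parcs G" "vwalk (z # q) (with_proj G)"
      by simp_all
    moreover have "last (z # q) = y" "vwalk_length (z # q) = n"
      using p q by simp_all
    ultimately have "(x, z) \<in> parcs G" "(z, y) \<in> parcs G ^^ n"
      using Suc.IH[of z] by (auto intro!: exI[of _ "z # q"])
    then show "x \<in> pverts G \<and> (x, y) \<in> parcs G ^^ Suc n"
      using in_arcsD1 relpow_Suc_I2 by metis
  next
    assume x: "x \<in> pverts G \<and> (x, y) \<in> parcs G ^^ Suc n"
    then obtain z where z: "(x, z) \<in> parcs G" "(z, y) \<in> parcs G ^^ n"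
      using relpow_Suc_D2 by metis
    then obtain p where p: "vwalk p (with_proj G)" "hd p = z" "last p = y" "vwalk_length p = n"
      using Suc.IH[of z] in_arcsD2 by auto
    then have "p \<noteq> []" by auto
    then have "vwalk (x # p) (with_proj G) \<and> hd (x # p) = x \<and> last (x # p) = y
        \<and> vwalk_length (x # p) = Suc n"
      using p z(1) x by (auto intro!: vwalk_consI simp: neq_Nil_conv)
    then show "\<exists>p. vwalk p (with_proj G) \<and> hd p = x \<and> last p = y \<and> vwalk_length p = Suc n"
      by blast
  qed
qed

lemma graph_dist_eq: "x \<in> pverts G \<Longrightarrow> graph_dist G x y = (LEAST n. (x, y) \<in> parcs G ^^ n)"
  unfolding graph_dist_def vwalk_iff_relpow by simp

lemma graph_distI:
  assumes "x \<in> pverts G" "(x, y) \<in> parcs G ^^ n" "\<And>k. k < n \<Longrightarrow> (x, y) \<notin> parcs G ^^ k"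
  shows "graph_dist G x y = n"
  unfolding graph_dist_eq[OF assms(1)] using assms(2,3)
  by (intro Least_equality) (auto simp: not_less[symmetric])

lemma reachable_iff_relpow: "x \<rightarrow>\<^sup>*\<^bsub>with_proj G\<^esub> y \<longleftrightarrow> x \<in> pverts G \<and> (\<exists>n. (x, y) \<in> parcs G ^^ n)"
  unfolding reachable_vwalk_conv using vwalk_iff_relpow by blast

lemma connected_iff_relpow:
  "Digraph_Component.connected (with_proj G) \<longleftrightarrow>
    pverts G \<noteq> {} \<and> (\<forall>x\<in>pverts G. \<forall>y\<in>pverts G. \<exists>n. (x, y) \<in> parcs G ^^ n)"
proof
  assume "Digraph_Component.connected (with_proj G)"
  then have "strongly_connected (with_proj G)"
    using sym_arcs by (rule symmetric_connected_imp_strongly_connected[rotated])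
  then show "pverts G \<noteq> {} \<and> (\<forall>x\<in>pverts G. \<forall>y\<in>pverts G. \<exists>n. (x, y) \<in> parcs G ^^ n)"
    by (simp add: strongly_connected_def reachable_iff_relpow)
next
  assume R: "pverts G \<noteq> {} \<and> (\<forall>x\<in>pverts G. \<forall>y\<in>pverts G. \<exists>n. (x, y) \<in> parcs G ^^ n)"
  then have "x \<rightarrow>\<^sup>*\<^bsub>with_proj G\<^esub> y" if "x \<in> pverts G" "y \<in> pverts G" for x y
    using that by (simp add: reachable_iff_relpow)
  then show "Digraph_Component.connected (with_proj G)"
    unfolding connected_def using R
    by (intro strongly_connectedI) (simp_all add: reachable_mk_symmetricI)
qed

lemma relpow_sym: "(x, y) \<in> parcs G ^^ n \<Longrightarrow> (y, x) \<in> parcs G ^^ n"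
  by (induction n arbitrary: y) (auto intro: relpow_Suc_I2 arcs_symmetric simp del: relpow.simps(2) elim!: relpow_Suc_E)

lemma graph_dist_sym:
  assumes "x \<in> pverts G" "y \<in> pverts G"
  shows "graph_dist G x y = graph_dist G y x"
  unfolding graph_dist_eq[OF assms(1)] graph_dist_eq[OF assms(2)]
  by (metis relpow_sym)

lemma relpow_graph_dist:
  assumes "Digraph_Component.connected (with_proj G)" "x \<in> pverts G" "y \<in> pverts G"
  shows "(x, y) \<in> parcs G ^^ graph_dist G x y"
proof -
  obtain n where "(x, y) \<in> parcs G ^^ n"
    using assms connected_iff_relpow by blast
  then show ?thesis
    unfolding graph_dist_eq[OF assms(2)] by (rule LeastI)
qed

lemma graph_dist_eq_0:
  assumes "Digraph_Component.connected (with_proj G)" "x \<in> pverts G" "y \<in> pverts G"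
  shows "graph_dist G x y = 0 \<longleftrightarrow> x = y"
proof
  assume "graph_dist G x y = 0"
  then show "x = y" using relpow_graph_dist[OF assms] by simp
next
  assume "x = y"
  then show "graph_dist G x y = 0"
    using assms(2) by (intro graph_distI) auto
qed

lemma graph_dist_eq_1:
  assumes "Digraph_Component.connected (with_proj G)" "x \<in> pverts G" "y \<in> pverts G"
  shows "graph_dist G x y = 1 \<longleftrightarrow> (x, y) \<in> parcs G"
proof
  assume "graph_dist G x y = 1"
  then show "(x, y) \<in> parcs G" using relpow_graph_dist[OF assms] by simp
next
  assume "(x, y) \<in> parcs G"
  then show "graph_dist G x y = 1"
    using assms(2) no_loops' by (intro graph_distI) auto
qed

lemma graph_dist_le_diameter:
  assumes "x \<in> pverts G" "y \<in> pverts G"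
  shows "graph_dist G x y \<le> graph_diameter G"
proof -
  have "{graph_dist G x y |x y. x \<in> pverts G \<and> y \<in> pverts G}
      = (\<lambda>(x, y). graph_dist G x y) ` (pverts G \<times> pverts G)"
    by auto
  then have "finite {graph_dist G x y |x y. x \<in> pverts G \<and> y \<in> pverts G}"
    using pair_finite_verts by simp
  then show ?thesis
    unfolding graph_diameter_def using assms by (intro Max_ge) auto
qed

end

section \<open>From Gram matrices to Taylor graphs\<close>

text \<open>The second intersection number. Of the two roots \<open>\<plusminus>sqrt (m + 2)\<close>, this sign belongs to calling points
  adjacent when their inner product is positive; the other one belongs to the distance 2 graph.\<close>

definition taylor_mu :: "nat \<Rightarrow> real" where
  "taylor_mu m = ((real m)\<^sup>2 + real m - 4 - (real m - 3) * sqrt (real m + 2)) / 4"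

definition taylor_array :: "nat \<Rightarrow> 'a pair_pre_digraph \<Rightarrow> bool" where
  "taylor_array m G \<longleftrightarrow> (\<exists>k \<mu>. real k = (real m - 1) * (real m + 2) / 2 \<and>
    real \<mu> = taylor_mu m \<and> has_intersection_array G [k, \<mu>, 1] [1, \<mu>, k])"

text \<open>Positivity of \<open>\<mu>\<close> gives points with inner product \<open>- angle_cos m\<close> a common neighbour, so that graph
  distances can be read off the Gram matrix.\<close>

lemma taylor_mu_pos:
  assumes "m \<ge> 3"
  shows "taylor_mu m > 0"
proof -
  have m: "real m \<ge> 3" using assms by simp
  have "real m + 2 \<le> (real m)\<^sup>2"
    using mult_mono[of 3 "real m" 1 "real m - 2"] mult_mono[OF m m] m by (simp add: power2_eq_square algebra_simps)
  then have "sqrt (real m + 2) \<le> real m"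
    by (simp add: real_le_lsqrt)
  then have "(real m - 3) * sqrt (real m + 2) \<le> (real m - 3) * real m"
    using m by (intro mult_left_mono) auto
  then show ?thesis
    using m by (simp add: taylor_mu_def power2_eq_square algebra_simps)
qed

context taylor_gram
begin

lemma card_nbrs:
  assumes "y \<in> V"
  shows "real (card (nbrs y)) = (real m - 1) * (real m + 2) / 2"
proof -
  have "real (m * (m + 1)) = real (2 + 2 * card (nbrs y))"
    using card_V_nbrs[OF assms] card_V by simp
  then show ?thesis
    by (simp add: field_simps)
qed

lemma sum_nbrs:
  assumes "x \<in> V" "y \<in> V"
  shows "2 * angle_cos m * (\<Sum>z\<in>nbrs y. g x z) = (real m - 1) * g x y"
  using gram_square[OF assms] gram_square_nbrs[OF assms] by (simp add: algebra_simps)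

text \<open>The eigenvector equation \<open>sum_nbrs\<close> at an edge: the sum there is \<open>1\<close>, contributed by \<open>x\<close>, plus
  \<open>angle_cos m\<close> times the difference counted here.\<close>

lemma card_nbrs_difference:
  assumes "x \<in> V" "y \<in> V" "g x y = angle_cos m"
  shows "real (card {z \<in> nbrs y. g x z = angle_cos m}) - real (card {z \<in> nbrs y. g x z = - angle_cos m})
    = (real m - 3) / 2 * sqrt (real m + 2)"
proof -
  let ?D = "real (card {z \<in> nbrs y. g x z = angle_cos m}) - real (card {z \<in> nbrs y. g x z = - angle_cos m})"
  have "2 * (1 + angle_cos m * ?D) = real m - 1"
    using sum_nbrs[OF assms(1,2)] angle_cos_bounds[of m]
    unfolding sum_nbrs_split[OF assms] assms(3) by simp
  then have "angle_cos m * ?D = (real m - 3) / 2"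
    by (simp add: field_simps)
  then show ?thesis
    by (simp add: angle_cos_def field_simps)
qed

lemma card_nbrs_far:
  assumes "x \<in> V" "y \<in> V" "g x y = angle_cos m"
  shows "real (card {z \<in> nbrs y. g x z = - angle_cos m}) = taylor_mu m"
proof -
  have "real (card (nbrs y)) = 1 + real (card {z \<in> nbrs y. g x z = angle_cos m})
      + real (card {z \<in> nbrs y. g x z = - angle_cos m})"
    using card_nbrs_split[OF assms] by simp
  then show ?thesis
    using card_nbrs_difference[OF assms] card_nbrs[OF assms(2)]
    by (simp add: taylor_mu_def power2_eq_square field_simps)
qed

lemma card_nbrs_common_pos:
  assumes "x \<in> V" "y \<in> V" "g x y = angle_cos m"
  shows "card {z \<in> nbrs y. g x z = angle_cos m} > 0"
proof -
  have "(real m - 3) / 2 * sqrt (real m + 2) \<ge> 0"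
    using m_ge_3 by simp
  then have "real (card {z \<in> nbrs y. g x z = angle_cos m}) \<ge> taylor_mu m"
    using card_nbrs_difference[OF assms] card_nbrs_far[OF assms] by linarith
  then show ?thesis
    using taylor_mu_pos[OF m_ge_3] by linarith
qed

text \<open>Since \<open>\<tau> x\<close> and \<open>y\<close> are adjacent, there are \<open>\<mu> > 0\<close> neighbours of \<open>y\<close> that are far from \<open>\<tau> x\<close>, that is,
  adjacent to \<open>x\<close>.\<close>

lemma common_nbr:
  assumes "x \<in> V" "y \<in> V" "g x y = - angle_cos m"
  obtains z where "z \<in> V" "g x z = angle_cos m" "g z y = angle_cos m"
proof -
  have "real (card {z \<in> nbrs y. g (\<tau> x) z = - angle_cos m}) > 0"
    using card_nbrs_far[of "\<tau> x" y] assms taylor_mu_pos[OF m_ge_3]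
    by (simp add: antipode_in gram_antipode_left)
  then obtain z where "z \<in> nbrs y" "g (\<tau> x) z = - angle_cos m"
    by (auto simp: card_gt_0_iff)
  then show ?thesis
    using assms by (intro that[of z]) (auto simp: nbrs_def gram_antipode_left gram_sym)
qed

lemma nbrs_nonempty:
  assumes "y \<in> V"
  shows "nbrs y \<noteq> {}"
proof
  assume "nbrs y = {}"
  then show False
    using card_nbrs[OF assms] m_ge_3 by simp
qed

lemma V_nonempty: "V \<noteq> {}"
  using card_V m_ge_3 by auto

end

locale taylor_gram_graph = taylor_gram m V g \<tau>
  for m :: nat and V :: "'a set" and g \<tau> +
  fixes G :: "'a pair_pre_digraph"
  assumes pverts_eq: "pverts G = V"
    and parcs_eq: "parcs G = {(x, y). x \<in> V \<and> y \<in> V \<and> g x y = angle_cos m}"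
begin

lemma pair_graph_G: "pair_graph G"
proof -
  have "parcs G \<subseteq> V \<times> V"
    by (auto simp: parcs_eq)
  then have "finite (parcs G)"
    using finite_V finite_subset by blast
  moreover have "g x x \<noteq> angle_cos m" if "x \<in> V" for x
    using that angle_cos_bounds[of m] by (simp add: gram_self)
  ultimately show ?thesis
    using finite_V
    by unfold_locales (auto simp: pverts_eq parcs_eq symmetric_def gram_sym intro!: symI)
qed

interpretation pair_graph G
  by (rule pair_graph_G)

lemma gram_cases:
  assumes "x \<in> V" "y \<in> V"
  obtains "g x y = 1" "y = x" | "g x y = -1" "y = \<tau> x" | "g x y = angle_cos m" | "g x y = - angle_cos m"
  using gram_values[OF assms] gram_eq_1[OF assms] gram_eq_minus_1[OF assms] by blast

text \<open>Antipodal points are at distance 3: a neighbour of \<open>x\<close> has inner product \<open>- angle_cos m\<close> with \<open>\<tau> x\<close>, so it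
  is joined to \<open>\<tau> x\<close> by a path of length 2, but not adjacent to it. The walk is part of the statement because it also
  proves connectedness.\<close>

lemma graph_dist_gram:
  assumes "x \<in> V" "y \<in> V"
  shows "(x, y) \<in> parcs G ^^ graph_dist G x y \<and>
    graph_dist G x y = (if g x y = 1 then 0 else if g x y = angle_cos m then 1
      else if g x y = - angle_cos m then 2 else 3)"
proof -
  note [simp] = pverts_eq
  have a: "0 < angle_cos m" "angle_cos m < 1"
    using angle_cos_bounds by auto
  have two: "(x, y) \<in> parcs G ^^ 2 \<longleftrightarrow> (\<exists>z. (x, z) \<in> parcs G \<and> (z, y) \<in> parcs G)"
    by (auto simp: numeral_2_eq_2)
  have distI: ?thesis
    if "(x, y) \<in> parcs G ^^ n" "\<And>k. k < n \<Longrightarrow> (x, y) \<notin> parcs G ^^ k"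
      "n = (if g x y = 1 then 0 else if g x y = angle_cos m then 1
        else if g x y = - angle_cos m then 2 else 3)" for n
    using graph_distI[of x y n] that assms by simp
  show ?thesis
  proof (cases rule: gram_cases[OF assms])
    case 1
    then show ?thesis by (intro distI[of 0]) auto
  next
    case 3
    then show ?thesis
      using assms a by (intro distI[of 1]) (auto simp: parcs_eq gram_self)
  next
    case 4
    obtain z where "z \<in> V" "g x z = angle_cos m" "g z y = angle_cos m"
      using common_nbr assms 4 by blast
    then have "(x, y) \<in> parcs G ^^ 2"
      unfolding two using assms by (auto simp: parcs_eq)
    moreover have "(x, y) \<notin> parcs G ^^ k" if "k < 2" for k
    proof -
      have "k = 0 \<or> k = 1" using that by arith
      then show ?thesis
        using 4 a assms by (auto simp: parcs_eq gram_self)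
    qed
    ultimately show ?thesis
      using 4 a by (intro distI[of 2]) auto
  next
    case 2
    obtain z where z: "z \<in> V" "g x z = angle_cos m"
      using nbrs_nonempty[OF assms(1)] by (auto simp: nbrs_def)
    then have "g z y = - angle_cos m"
      using 2 assms by (simp add: gram_antipode_right gram_sym)
    then obtain w where "w \<in> V" "g z w = angle_cos m" "g w y = angle_cos m"
      using common_nbr z assms by blast
    then have "(x, z) \<in> parcs G" "(z, w) \<in> parcs G" "(w, y) \<in> parcs G"
      using z assms by (auto simp: parcs_eq)
    then have "(x, y) \<in> parcs G ^^ 3"
      by (auto simp: numeral_3_eq_3)
    moreover have "(x, y) \<notin> parcs G ^^ k" if "k < 3" for k
    proof -
      have "k = 0 \<or> k = 1 \<or> k = 2" using that by arith
      moreover have "(x, y) \<notin> parcs G ^^ 2"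
        unfolding two using 2 a assms by (auto simp: parcs_eq gram_antipode_right gram_sym)
      ultimately show ?thesis
        using 2 a assms antipode_neq[OF assms(1)] by (auto simp: parcs_eq)
    qed
    ultimately show ?thesis
      using 2 a by (intro distI[of 3]) auto
  qed
qed

lemma graph_dist_iff:
  assumes "x \<in> V" "y \<in> V"
  shows "graph_dist G x y = 0 \<longleftrightarrow> y = x" "graph_dist G x y = Suc 0 \<longleftrightarrow> g x y = angle_cos m"
    "graph_dist G x y = 2 \<longleftrightarrow> g x y = - angle_cos m" "graph_dist G x y = 3 \<longleftrightarrow> y = \<tau> x"
    "graph_dist G x y \<le> 3"
  using graph_dist_gram[OF assms] angle_cos_bounds[of m] assms antipode_neq[OF assms(1)]
  by (cases rule: gram_cases[OF assms]; auto simp: gram_self gram_antipode_right)+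

lemma connected_G: "Digraph_Component.connected (with_proj G)"
  unfolding connected_iff_relpow using graph_dist_gram V_nonempty by (auto simp: pverts_eq)

lemma neighbours_G: "y \<in> V \<Longrightarrow> neighbours G y = nbrs y"
  by (auto simp: neighbours_def nbrs_def parcs_eq)

lemma diameter_G: "graph_diameter G = 3"
  unfolding graph_diameter_def
proof (rule Max_eqI)
  have "{graph_dist G x y |x y. x \<in> pverts G \<and> y \<in> pverts G} \<subseteq> {..3}"
    by (auto simp: pverts_eq graph_dist_iff)
  then show "finite {graph_dist G x y |x y. x \<in> pverts G \<and> y \<in> pverts G}"
    by (rule finite_subset) simp
  obtain x where x: "x \<in> V" using V_nonempty by blast
  then have "graph_dist G x (\<tau> x) = 3"
    by (simp add: graph_dist_iff antipode_in)
  then show "3 \<in> {graph_dist G x y |x y. x \<in> pverts G \<and> y \<in> pverts G}"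
    using x antipode_in[OF x] unfolding pverts_eq by force
qed (auto simp: pverts_eq graph_dist_iff)

lemma taylor_array_G: "taylor_array m G"
proof -
  obtain x0 y0 where xy0: "x0 \<in> V" "y0 \<in> V" "g x0 y0 = angle_cos m"
    using V_nonempty nbrs_nonempty by (auto simp: nbrs_def) blast
  define k where "k = card (nbrs x0)"
  define \<mu> where "\<mu> = card {z \<in> nbrs y0. g x0 z = - angle_cos m}"
  have k: "real k = (real m - 1) * (real m + 2) / 2"
    using card_nbrs[OF xy0(1)] by (simp add: k_def)
  have \<mu>: "real \<mu> = taylor_mu m"
    using card_nbrs_far[OF xy0] by (simp add: \<mu>_def)
  have card_k: "card (nbrs y) = k" if "y \<in> V" for y
  proof -
    have "real (card (nbrs y)) = real k"
      using card_nbrs[OF that] k by simp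
    then show ?thesis by simp
  qed
  have card_\<mu>: "card {z \<in> nbrs y. g x z = - angle_cos m} = \<mu>"
    if "x \<in> V" "y \<in> V" "g x y = angle_cos m" for x y
  proof -
    have "real (card {z \<in> nbrs y. g x z = - angle_cos m}) = real \<mu>"
      using card_nbrs_far[OF that] \<mu> by simp
    then show ?thesis by simp
  qed
  have a: "0 < angle_cos m" "angle_cos m < 1"
    using angle_cos_bounds by auto
  have "(graph_dist G x y < 3 \<longrightarrow>
        card {z \<in> neighbours G y. graph_dist G x z = graph_dist G x y + 1} = [k, \<mu>, 1] ! graph_dist G x y) \<and>
      (1 \<le> graph_dist G x y \<longrightarrow>
        card {z \<in> neighbours G y. graph_dist G x z = graph_dist G x y - 1} = [1, \<mu>, k] ! (graph_dist G x y - 1))"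
    if xy: "x \<in> V" "y \<in> V" for x y
  proof -
    have N: "neighbours G y = nbrs y"
      using xy(2) by (rule neighbours_G)
    have nbrsD: "z \<in> V" "g y z = angle_cos m" "g z y = angle_cos m" if "z \<in> nbrs y" for z
      using that xy by (auto simp: nbrs_def gram_sym)
    show ?thesis
    proof (cases rule: gram_cases[OF xy])
      case 1
      then have "{z \<in> nbrs y. graph_dist G x z = Suc 0} = nbrs y"
        using nbrsD xy by (auto simp: graph_dist_iff)
      moreover have "graph_dist G x y = 0"
        using 1 xy by (simp add: graph_dist_iff)
      ultimately show ?thesis
        using card_k[OF xy(2)] by (simp add: N)
    next
      case 3
      then have "{z \<in> nbrs y. graph_dist G x z = 2} = {z \<in> nbrs y. g x z = - angle_cos m}"
        using nbrsD xy by (auto simp: graph_dist_iff)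
      moreover have "x \<in> nbrs y"
        using 3 xy gram_sym[of x y] by (simp add: nbrs_def)
      then have "{z \<in> nbrs y. graph_dist G x z = 0} = {x}"
        using nbrsD xy by (auto simp: graph_dist_iff)
      moreover have "graph_dist G x y = Suc 0"
        using 3 xy by (simp add: graph_dist_iff)
      ultimately show ?thesis
        using card_\<mu>[OF xy 3] by (simp add: N numeral_2_eq_2)
    next
      case 4
      have "\<tau> x \<in> nbrs y"
        using 4 xy gram_sym[of x y] by (simp add: nbrs_def gram_antipode_right antipode_in)
      then have "{z \<in> nbrs y. graph_dist G x z = 3} = {\<tau> x}"
        using nbrsD xy by (auto simp: graph_dist_iff)
      moreover have "{z \<in> nbrs y. graph_dist G x z = Suc 0} = {z \<in> nbrs y. g (\<tau> x) z = - angle_cos m}"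
        using nbrsD xy by (auto simp: graph_dist_iff gram_antipode_left)
      moreover have "graph_dist G x y = 2"
        using 4 xy by (simp add: graph_dist_iff)
      moreover have "card {z \<in> nbrs y. g (\<tau> x) z = - angle_cos m} = \<mu>"
        using xy 4 by (intro card_\<mu>) (simp_all add: antipode_in gram_antipode_left)
      ultimately show ?thesis
        by (simp add: N)
    next
      case 2
      have "g x z = - angle_cos m" if "z \<in> nbrs y" for z
        using nbrsD[OF that] 2 xy by (simp add: gram_antipode_left)
      then have "{z \<in> nbrs y. graph_dist G x z = 2} = nbrs y"
        using nbrsD xy by (auto simp: graph_dist_iff)
      moreover have "graph_dist G x y = 3"
        using 2 xy by (simp add: graph_dist_iff)
      ultimately show ?thesis
        using card_k[OF xy(2)] by (simp add: N)
    qed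
  qed
  then have "has_intersection_array G [k, \<mu>, 1] [1, \<mu>, k]"
    unfolding has_intersection_array_def diameter_G pverts_eq
    using pair_graph_G connected_G by simp
  then show ?thesis
    using k \<mu> by (auto simp: taylor_array_def)
qed

lemma antipodal_rel_G: "antipodal_rel G = {(x, y). x \<in> V \<and> (y = x \<or> y = \<tau> x)}"
  by (auto simp: antipodal_rel_def pverts_eq diameter_G graph_dist_iff antipode_in)

lemma antipodal_class: "x \<in> V \<Longrightarrow> antipodal_rel G `` {x} = {x, \<tau> x}"
  by (auto simp: antipodal_rel_G)

lemma antipodal_G: "antipodal G"
  unfolding antipodal_def antipodal_rel_G pverts_eq
  by (intro equivI refl_onI symI transI) (auto simp: antipode_in antipode_antipode)

lemma antipodal_quotient: "pverts G // antipodal_rel G = (\<lambda>x. {x, \<tau> x}) ` V"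
  by (auto simp: quotient_def pverts_eq antipodal_class)

lemma fibre_eq_iff: "x \<in> V \<Longrightarrow> y \<in> V \<Longrightarrow> {x, \<tau> x} = {y, \<tau> y} \<longleftrightarrow> y = x \<or> y = \<tau> x"
  by (auto simp: doubleton_eq_iff antipode_antipode)

text \<open>Of two antipodal points, exactly one has a positive inner product with a given third point. This is why
  the folded graph is complete and why the projection onto it is a covering.\<close>

lemma adjacent_fibre_member:
  assumes "x \<in> V" "y \<in> V" "{x, \<tau> x} \<noteq> {y, \<tau> y}"
  obtains z where "z \<in> {y, \<tau> y}" "z \<in> V" "g x z = angle_cos m"
proof (cases rule: gram_cases[OF assms(1,2)])
  case 4
  then show ?thesis
    using assms by (intro that[of "\<tau> y"]) (simp_all add: antipode_in gram_antipode_right)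
qed (use assms that fibre_eq_iff in auto)

lemma folded_verts: "pverts (folded_graph G) = (\<lambda>x. {x, \<tau> x}) ` V"
  by (simp add: folded_graph_def antipodal_quotient)

lemma folded_arcs:
  "parcs (folded_graph G) = {(A, B). A \<in> pverts (folded_graph G) \<and> B \<in> pverts (folded_graph G) \<and> A \<noteq> B}"
proof -
  have "\<exists>x\<in>A. \<exists>y\<in>B. (x, y) \<in> parcs G"
    if AB: "A \<in> pverts G // antipodal_rel G" "B \<in> pverts G // antipodal_rel G" "A \<noteq> B" for A B
  proof -
    obtain x y where xy: "x \<in> V" "y \<in> V" "A = {x, \<tau> x}" "B = {y, \<tau> y}"
      using AB unfolding antipodal_quotient by blast
    obtain z where "z \<in> B" "z \<in> V" "g x z = angle_cos m"
      using adjacent_fibre_member xy AB(3) by metis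
    then show ?thesis
      using xy by (auto simp: parcs_eq)
  qed
  then show ?thesis
    by (auto simp: folded_graph_def)
qed

lemma antipodal_double_cover_G: "antipodal_double_cover G"
  unfolding antipodal_double_cover_def
proof (intro conjI ballI)
  fix A assume "A \<in> pverts G // antipodal_rel G"
  then show "card A = 2"
    using antipode_neq by (force simp: antipodal_quotient)
next
  fix x assume "x \<in> pverts G"
  then have x: "x \<in> V" by (simp add: pverts_eq)
  have a: "0 < angle_cos m" "angle_cos m < 1"
    using angle_cos_bounds by auto
  have cls: "antipodal_rel G `` {y} = {y, \<tau> y}" if "y \<in> nbrs x" for y
    using that by (simp add: nbrs_def antipodal_class)
  show "bij_betw (\<lambda>y. antipodal_rel G `` {y}) (neighbours G x)
      (neighbours (folded_graph G) (antipodal_rel G `` {x}))"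
    unfolding bij_betw_def
  proof
    show "inj_on (\<lambda>y. antipodal_rel G `` {y}) (neighbours G x)"
    proof (rule inj_onI)
      fix y z assume yz: "y \<in> neighbours G x" "z \<in> neighbours G x"
        and eq: "antipodal_rel G `` {y} = antipodal_rel G `` {z}"
      then have V: "y \<in> V" "z \<in> V" "g x y = angle_cos m" "g x z = angle_cos m"
        using x by (simp_all add: neighbours_G nbrs_def)
      have "z = y \<or> z = \<tau> y"
        using eq V fibre_eq_iff by (simp add: antipodal_class)
      then show "y = z"
        using V x a by (auto simp: gram_antipode_right)
    qed
    show "(\<lambda>y. antipodal_rel G `` {y}) ` neighbours G x
        = neighbours (folded_graph G) (antipodal_rel G `` {x})"
    proof (intro set_eqI iffI)
      fix B assume "B \<in> (\<lambda>y. antipodal_rel G `` {y}) ` neighbours G x"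
      then obtain y where y: "y \<in> nbrs x" "B = {y, \<tau> y}"
        using x cls by (auto simp: neighbours_G)
      then have "y \<in> V" "y \<noteq> x" "y \<noteq> \<tau> x"
        using x a by (auto simp: nbrs_def gram_self gram_antipode_right)
      then have "B \<in> pverts (folded_graph G)" "{x, \<tau> x} \<in> pverts (folded_graph G)" "{x, \<tau> x} \<noteq> B"
        using x y(2) fibre_eq_iff[of x y] by (simp_all add: folded_verts)
      then show "B \<in> neighbours (folded_graph G) (antipodal_rel G `` {x})"
        using x by (simp add: neighbours_def folded_arcs antipodal_class)
    next
      fix B assume "B \<in> neighbours (folded_graph G) (antipodal_rel G `` {x})"
      then have "B \<in> (\<lambda>x. {x, \<tau> x}) ` V" and ne: "{x, \<tau> x} \<noteq> B"
        using x by (simp_all add: neighbours_def folded_arcs folded_verts antipodal_class)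
      then obtain y where y: "y \<in> V" "B = {y, \<tau> y}" by auto
      obtain z where z: "z \<in> {y, \<tau> y}" "z \<in> V" "g x z = angle_cos m"
        using adjacent_fibre_member x y ne by metis
      have "B = antipodal_rel G `` {z}"
        using z y antipode_antipode by (auto simp: antipodal_class)
      moreover have "z \<in> neighbours G x"
        using z x by (simp add: neighbours_G nbrs_def)
      ultimately show "B \<in> (\<lambda>y. antipodal_rel G `` {y}) ` neighbours G x" by blast
    qed
  qed
qed (rule antipodal_G)

lemma taylor_graph_G: "taylor_graph G"
proof -
  have "distance_regular G"
    using taylor_array_G by (auto simp: distance_regular_def taylor_array_def)
  moreover have "complete_digraph (card (pverts (folded_graph G))) (with_proj (folded_graph G))"
    unfolding complete_digraph_pair_def folded_arcs
    using finite_V by (auto simp: folded_verts)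
  ultimately show ?thesis
    unfolding taylor_graph_def using diameter_G antipodal_double_cover_G by blast
qed

text \<open>Adjacent vertices have a common neighbour, so there is a triangle.\<close>

lemma not_bipartite_G: "\<not> bipartite G"
proof
  assume "bipartite G"
  then obtain A B where AB: "A \<union> B = V" "A \<inter> B = {}" "parcs G \<subseteq> A \<times> B \<union> B \<times> A"
    by (auto simp: bipartite_def pverts_eq)
  obtain x where x: "x \<in> V" using V_nonempty by blast
  obtain y where y: "y \<in> V" "g x y = angle_cos m"
    using nbrs_nonempty[OF x] by (auto simp: nbrs_def)
  obtain z where "z \<in> nbrs y" "g x z = angle_cos m"
    using card_nbrs_common_pos[OF x y] by (auto simp: card_gt_0_iff)
  then have "(x, y) \<in> parcs G" "(y, z) \<in> parcs G" "(x, z) \<in> parcs G"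
    using x y by (auto simp: parcs_eq nbrs_def)
  then show False
    using AB by blast
qed

end

section \<open>From Taylor graphs to Gram matrices\<close>

text \<open>The covering property makes the antipode exchange distances \<open>1\<close> and \<open>2\<close>, so the matrix with entries
  \<open>1, \<alpha>, - \<alpha>, -1\<close> changes sign under \<open>\<tau>\<close>. It then suffices to verify the matrix equation at entries for
  distances \<open>0\<close> and \<open>1\<close>; there it only involves \<open>k\<close> and \<open>\<mu>\<close>, and holds by the choice of \<open>\<alpha>\<close>.\<close>

lemma taylor_graph_imp_gram:
  assumes taylor: "taylor_graph G" and array: "taylor_array m G" and m: "m \<ge> 3"
  obtains g \<tau> where "taylor_gram_graph m (pverts G) g \<tau> G"
proof -
  define V where "V = pverts G"
  define d where "d = graph_dist G"
  define \<alpha> where "\<alpha> = angle_cos m"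
  have alpha: "0 < \<alpha>" "\<alpha> < 1"
    unfolding \<alpha>_def by (rule angle_cos_bounds)+
  have alpha_sq: "\<alpha> * \<alpha> = 1 / (real m + 2)"
    using angle_cos_square[of m] by (simp add: \<alpha>_def power2_eq_square)
  obtain k \<mu> where k: "real k = (real m - 1) * (real m + 2) / 2" and \<mu>: "real \<mu> = taylor_mu m"
    and ia: "has_intersection_array G [k, \<mu>, 1] [1, \<mu>, k]"
    using array by (auto simp: taylor_array_def)
  interpret pair_graph G
    using ia by (simp add: has_intersection_array_def)
  have diam: "graph_diameter G = 3"
    using taylor by (simp add: taylor_graph_def)
  have conn: "Digraph_Component.connected (with_proj G)"
    using ia by (simp add: has_intersection_array_def)
  have cover: "antipodal_double_cover G"
    using taylor by (simp add: taylor_graph_def)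
  have equiv: "equiv V (antipodal_rel G)"
    using cover by (simp add: antipodal_double_cover_def antipodal_def V_def)
  have array_b: "card {z \<in> neighbours G y. d x z = d x y + 1} = [k, \<mu>, 1] ! d x y"
    if "x \<in> V" "y \<in> V" "d x y < 3" for x y
    using ia that by (simp add: has_intersection_array_def V_def d_def diam)
  have d_le: "d x y \<le> 3" if "x \<in> V" "y \<in> V" for x y
    using graph_dist_le_diameter that by (simp add: d_def V_def diam)
  have d_sym: "d x y = d y x" if "x \<in> V" "y \<in> V" for x y
    using graph_dist_sym that by (simp add: d_def V_def)
  have d_0: "d x y = 0 \<longleftrightarrow> x = y" if "x \<in> V" "y \<in> V" for x y
    using graph_dist_eq_0[OF conn] that by (simp add: d_def V_def)
  have d_1: "d x y = 1 \<longleftrightarrow> (x, y) \<in> parcs G" if "x \<in> V" "y \<in> V" for x y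
    using graph_dist_eq_1[OF conn] that by (simp add: d_def V_def)
  have nbrsD: "y \<in> V" "d x y = 1" if "y \<in> neighbours G x" for x y
    using that d_1[of x y] in_arcsD1 in_arcsD2 by (auto simp: neighbours_def V_def)
  have nbrs_iff: "y \<in> neighbours G x \<longleftrightarrow> y \<in> V \<and> d x y = 1" if "x \<in> V" for x y
    using that d_1[of x y] nbrsD[of y x] by (auto simp: neighbours_def)

  have "\<exists>y. antipodal_rel G `` {x} = {x, y} \<and> y \<noteq> x" if "x \<in> V" for x
  proof -
    have "card (antipodal_rel G `` {x}) = 2"
      using cover that quotientI[of x V] by (simp add: antipodal_double_cover_def V_def)
    then obtain a b where ab: "antipodal_rel G `` {x} = {a, b}" "a \<noteq> b"
      by (auto simp: card_2_iff)
    have "x \<in> {a, b}"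
      unfolding ab(1)[symmetric] using equiv that by (rule equiv_class_self)
    then show ?thesis
      using ab by auto
  qed
  then obtain \<tau> where \<tau>: "\<And>x. x \<in> V \<Longrightarrow> antipodal_rel G `` {x} = {x, \<tau> x} \<and> \<tau> x \<noteq> x"
    by metis
  have antipode_in: "\<tau> x \<in> V" and d_antipode: "d x (\<tau> x) = 3" if x: "x \<in> V" for x
  proof -
    have "(x, \<tau> x) \<in> antipodal_rel G"
      using \<tau>[OF x] by blast
    then show "\<tau> x \<in> V" "d x (\<tau> x) = 3"
      using \<tau>[OF x] d_0[of x "\<tau> x"] x by (auto simp: antipodal_rel_def diam V_def d_def)
  qed
  have d_3: "y = \<tau> x" if "x \<in> V" "y \<in> V" "d x y = 3" for x y
  proof -
    have "(x, y) \<in> antipodal_rel G"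
      using that by (simp add: antipodal_rel_def diam V_def d_def)
    then have "y \<in> {x, \<tau> x}"
      using \<tau>[OF that(1)] by blast
    then show ?thesis
      using that d_0[of x y] by auto
  qed
  have antipode_antipode: "\<tau> (\<tau> x) = x" if "x \<in> V" for x
    using d_3[of "\<tau> x" x] that antipode_in d_antipode d_sym by metis
  have bij: "bij_betw (\<lambda>y. antipodal_rel G `` {y}) (neighbours G x)
      (neighbours (folded_graph G) (antipodal_rel G `` {x}))" if "x \<in> V" for x
    using cover that by (simp add: antipodal_double_cover_def V_def)
  have d_antipode_2: "d x (\<tau> y) = 2" if xy: "x \<in> V" "y \<in> V" "d x y = 1" for x y
  proof -
    have "d x (\<tau> y) \<noteq> 0"
      using xy d_0[of x "\<tau> y"] d_antipode[of y] d_sym[of x y] antipode_in by auto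
    moreover have "d x (\<tau> y) \<noteq> 3"
      using xy d_3[of x "\<tau> y"] antipode_in antipode_antipode d_0[of x y] by (metis zero_neq_one)
    moreover have "d x (\<tau> y) \<noteq> 1"
    proof
      assume "d x (\<tau> y) = 1"
      then have "y \<in> neighbours G x" "\<tau> y \<in> neighbours G x"
        using xy antipode_in by (simp_all add: nbrs_iff)
      moreover have "antipodal_rel G `` {y} = antipodal_rel G `` {\<tau> y}"
        using \<tau>[of y] \<tau>[of "\<tau> y"] xy antipode_in antipode_antipode by auto
      ultimately have "y = \<tau> y"
        using bij[OF xy(1)] by (auto simp: bij_betw_def dest: inj_onD)
      then show False
        using \<tau>[OF xy(2)] by simp
    qed
    ultimately show ?thesis
      using d_le[of x "\<tau> y"] xy antipode_in by (simp add: le_Suc_eq numeral_3_eq_3 numeral_2_eq_2)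
  qed
  have d_antipode_1: "d x (\<tau> y) = 1" if xy: "x \<in> V" "y \<in> V" "d x y = 2" for x y
  proof -
    obtain n where "complete_digraph n (with_proj (folded_graph G))"
      using taylor by (auto simp: taylor_graph_def)
    then have arcs: "parcs (folded_graph G)
        = {(A, B). (A, B) \<in> (V // antipodal_rel G) \<times> (V // antipodal_rel G) \<and> A \<noteq> B}"
      by (simp add: complete_digraph_pair_def folded_graph_def V_def)
    have "y \<notin> antipodal_rel G `` {x}"
      using \<tau>[OF xy(1)] xy d_0[of x y] d_antipode[of x] by auto
    moreover have "y \<in> antipodal_rel G `` {y}"
      using \<tau>[OF xy(2)] by blast
    ultimately have "antipodal_rel G `` {y} \<in> neighbours (folded_graph G) (antipodal_rel G `` {x})"
      using xy by (auto simp: neighbours_def arcs intro!: quotientI)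
    then obtain z where z: "z \<in> neighbours G x" "antipodal_rel G `` {z} = antipodal_rel G `` {y}"
      unfolding bij_betw_imp_surj_on[OF bij[OF xy(1)], symmetric] by blast
    then have "z \<in> {y, \<tau> y}"
      using \<tau>[OF nbrsD(1)[OF z(1)]] \<tau>[OF xy(2)] by blast
    then show ?thesis
      using nbrsD[OF z(1)] xy by auto
  qed

  define g where "g = (\<lambda>x y. if d x y = 0 then 1 else if d x y = 1 then \<alpha>
    else if d x y = 2 then - \<alpha> else -1)"
  have gI: "d x y = 0 \<Longrightarrow> g x y = 1" "d x y = 1 \<Longrightarrow> g x y = \<alpha>" "d x y = 2 \<Longrightarrow> g x y = - \<alpha>"
    "d x y = 3 \<Longrightarrow> g x y = -1" for x y
    by (simp_all add: g_def)
  have g_sym: "g x y = g y x" if "x \<in> V" "y \<in> V" for x y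
    using d_sym[OF that] by (simp add: g_def)
  have g_right: "g x (\<tau> y) = - g x y" if xy: "x \<in> V" "y \<in> V" for x y
  proof -
    consider "d x y = 0" | "d x y = 1" | "d x y = 2" | "d x y = 3"
      using d_le[OF xy] by linarith
    then show ?thesis
    proof cases
      case 1
      then show ?thesis
        using xy d_0[of x y] d_antipode[of x] gI by auto
    next
      case 4
      then have "\<tau> y = x"
        using d_3[OF xy] antipode_antipode xy by simp
      then show ?thesis
        using 4 d_0[of x x] xy gI by simp
    qed (use xy d_antipode_1 d_antipode_2 gI in simp_all)
  qed
  interpret A: antipodal_gram \<alpha> V g \<tau>
  proof
    show "finite V" using pair_finite_verts by (simp add: V_def)
    show "g x y = 1 \<longleftrightarrow> x = y" if "x \<in> V" "y \<in> V" for x y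
      using d_0[OF that] alpha by (auto simp: g_def)
    show "g (\<tau> x) y = - g x y" if "x \<in> V" "y \<in> V" for x y
      using g_right[of y x] g_sym that antipode_in by metis
  qed (use alpha g_sym antipode_in in \<open>auto simp: g_def\<close>)
  have g_alpha: "g x y = \<alpha> \<longleftrightarrow> d x y = 1" and g_minus_alpha: "g x y = - \<alpha> \<longleftrightarrow> d x y = 2"
    if "x \<in> V" "y \<in> V" for x y
    using alpha d_le[OF that] by (auto simp: g_def)
  have nbrs: "A.nbrs y = neighbours G y" if "y \<in> V" for y
    using that by (intro set_eqI) (simp add: A.nbrs_def nbrs_iff g_alpha cong: conj_cong)
  have card_nbrs: "card (A.nbrs y) = k" if y: "y \<in> V" for y
  proof -
    have "{z \<in> neighbours G y. d y z = 1} = neighbours G y"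
      using nbrsD by auto
    moreover have "card {z \<in> neighbours G y. d y z = 1} = k"
      using array_b[OF y y] d_0[OF y y] by simp
    ultimately show ?thesis
      by (simp add: nbrs y)
  qed
  have card_far: "card {z \<in> A.nbrs y. g x z = - \<alpha>} = \<mu>" if xy: "x \<in> V" "y \<in> V" "g x y = \<alpha>" for x y
  proof -
    have d1: "d x y = 1" using xy g_alpha by simp
    have "{z \<in> A.nbrs y. g x z = - \<alpha>} = {z \<in> neighbours G y. graph_dist G x z = Suc (Suc 0)}"
    proof (intro set_eqI)
      fix z
      show "z \<in> {z \<in> A.nbrs y. g x z = - \<alpha>} \<longleftrightarrow> z \<in> {z \<in> neighbours G y. graph_dist G x z = Suc (Suc 0)}"
        using nbrsD(1)[of z y] g_minus_alpha[OF xy(1), of z] by (auto simp: nbrs[OF xy(2)] d_def)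
    qed
    moreover have "card {z \<in> neighbours G y. graph_dist G x z = Suc (Suc 0)} = \<mu>"
      using array_b[OF xy(1,2)] d1 by (simp add: d_def)
    ultimately show ?thesis by simp
  qed
  have sum_near: "2 * \<alpha> * (\<Sum>z\<in>A.nbrs y. g x z) = (real m - 1) * g x y"
    if xy: "x \<in> V" "y \<in> V" and near: "g x y = 1 \<or> g x y = \<alpha>" for x y
    using near
  proof
    assume "g x y = 1"
    then have "x = y" using A.gram_eq_1 xy by simp
    then have "(\<Sum>z\<in>A.nbrs y. g x z) = (\<Sum>z\<in>A.nbrs y. \<alpha>)"
      by (intro sum.cong) (auto simp: A.nbrs_def)
    then have "2 * \<alpha> * (\<Sum>z\<in>A.nbrs y. g x z) = 2 * real k * (\<alpha> * \<alpha>)"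
      using card_nbrs[OF xy(2)] by simp
    also have "\<dots> = real m - 1"
      unfolding alpha_sq k by simp
    finally show ?thesis
      using \<open>g x y = 1\<close> by simp
  next
    assume \<alpha>: "g x y = \<alpha>"
    let ?P = "card {z \<in> A.nbrs y. g x z = \<alpha>}"
    have P: "real ?P = real k - 1 - real \<mu>"
      using A.card_nbrs_split[OF xy \<alpha>] card_far[OF xy \<alpha>] card_nbrs[OF xy(2)] by simp
    have "real ?P - real \<mu> = (real m - 3) / 2 * sqrt (real m + 2)"
      unfolding P unfolding k \<mu> taylor_mu_def by (simp add: power2_eq_square field_simps)
    then have "\<alpha> * (real ?P - real \<mu>) = (real m - 3) / 2"
      by (simp add: \<alpha>_def angle_cos_def)
    then have sum_eq: "(\<Sum>z\<in>A.nbrs y. g x z) = 1 + (real m - 3) / 2"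
      unfolding A.sum_nbrs_split[OF xy \<alpha>] card_far[OF xy \<alpha>] by simp
    show ?thesis
      unfolding sum_eq \<alpha> by (simp add: field_simps)
  qed
  have sum_nbrs: "2 * \<alpha> * (\<Sum>z\<in>A.nbrs y. g x z) = (real m - 1) * g x y"
    if xy: "x \<in> V" "y \<in> V" for x y
  proof (cases "g x y = 1 \<or> g x y = \<alpha>")
    case True
    then show ?thesis using sum_near xy by blast
  next
    case False
    then have "g (\<tau> x) y = 1 \<or> g (\<tau> x) y = \<alpha>"
      using A.gram_values[OF xy] by (auto simp: A.gram_antipode_left xy)
    then have "2 * \<alpha> * (\<Sum>z\<in>A.nbrs y. g (\<tau> x) z) = (real m - 1) * g (\<tau> x) y"
      using sum_near xy antipode_in by blast
    moreover have "(\<Sum>z\<in>A.nbrs y. g (\<tau> x) z) = - (\<Sum>z\<in>A.nbrs y. g x z)"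
      unfolding sum_negf[symmetric] using xy
      by (intro sum.cong) (auto simp: A.gram_antipode_left A.nbrs_def)
    ultimately show ?thesis
      using xy by (simp add: A.gram_antipode_left)
  qed
  obtain y0 where y0: "y0 \<in> V"
    using conn connected_iff_relpow by (auto simp: V_def)
  have "real (card V) = real (m * (m + 1))"
    using A.card_V_nbrs[OF y0] card_nbrs[OF y0] k by (simp add: field_simps)
  then have card_V: "card V = m * (m + 1)"
    by (simp only: of_nat_eq_iff)
  have "taylor_gram_graph m V g \<tau> G"
  proof (intro taylor_gram_graph.intro taylor_gram.intro)
    show "antipodal_gram (angle_cos m) V g \<tau>"
      using A.antipodal_gram_axioms by (simp add: \<alpha>_def)
    show "taylor_gram_axioms m V g"
    proof
      fix x y assume xy: "x \<in> V" "y \<in> V"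
      show "(\<Sum>z\<in>V. g x z * g z y) = (real m + 1) * g x y"
        unfolding A.gram_square_nbrs[OF xy] sum_nbrs[OF xy] by (simp add: algebra_simps)
    qed (use m card_V in auto)
    show "taylor_gram_graph_axioms m V g G"
      by unfold_locales (use g_alpha d_1 in_arcsD1 in_arcsD2 in \<open>auto simp: V_def \<alpha>_def\<close>)
  qed
  then show ?thesis
    using that by (simp add: V_def)
qed

section \<open>Realizing a Gram matrix\<close>

text \<open>A self-adjoint idempotent is the orthogonal projection onto its range. Its rank, the size of an
  orthonormal basis of the range, is its trace.\<close>

lemma self_adjoint_idempotent_decomposition:
  fixes M :: "real ^ 'w::finite \<Rightarrow> real ^ 'w"
  assumes lin: "linear M" and idem: "\<And>v. M (M v) = M v" and adj: "\<And>v w. M v \<bullet> w = v \<bullet> M w"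
  obtains B where "finite B" "real (card B) = (\<Sum>i\<in>UNIV. M (axis i 1) $ i)"
    "\<And>v w. v \<bullet> M w = (\<Sum>b\<in>B. (v \<bullet> b) * (w \<bullet> b))"
proof -
  have "subspace (range M)"
    using lin by (simp add: linear_subspace_image)
  then obtain B where B: "B \<subseteq> range M" "pairwise orthogonal B" "\<And>x. x \<in> B \<Longrightarrow> norm x = 1"
    "independent B" "span B = range M"
    by (rule orthonormal_basis_subspace) blast
  have fin: "finite B"
    using B(4) by (rule independent_imp_finite)
  have fixed: "M b = b" if "b \<in> B" for b
    using that B(1) idem by auto
  have expand: "v \<bullet> M w = (\<Sum>b\<in>B. (v \<bullet> b) * (w \<bullet> b))" for v w
  proof -
    have "M w \<in> span B"
      using B(5) by simp
    then have "M w = (\<Sum>b\<in>B. (M w \<bullet> b) *\<^sub>R b)"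
      using orthonormal_basis_expand[OF B(2,3) _ fin] by simp
    then have "v \<bullet> M w = v \<bullet> (\<Sum>b\<in>B. (M w \<bullet> b) *\<^sub>R b)"
      by simp
    also have "\<dots> = (\<Sum>b\<in>B. (v \<bullet> b) * (w \<bullet> b))"
      unfolding inner_sum_right
      by (intro sum.cong refl) (simp add: adj fixed mult.commute)
    finally show ?thesis .
  qed
  have "(\<Sum>i\<in>UNIV. M (axis i 1) $ i) = (\<Sum>i\<in>UNIV. \<Sum>b\<in>B. b $ i * b $ i)"
    using expand[of "axis _ 1" "axis _ 1"] by (simp add: inner_axis')
  also have "\<dots> = (\<Sum>b\<in>B. b \<bullet> b)"
    by (subst sum.swap) (simp add: inner_vec_def)
  also have "\<dots> = real (card B)"
    using B(3) by (simp add: norm_eq_1)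
  finally show ?thesis
    using that[OF fin _ expand] by simp
qed

text \<open>The Gram matrix divided by \<open>m + 1\<close> is a projection of trace \<open>m (m + 1) / (m + 1) = m\<close>. The coordinates
  of the unit vectors with respect to an orthonormal basis of its range, rescaled, have the given inner products.\<close>

lemma (in taylor_gram) realization:
  assumes m: "m = CARD('n::finite)"
  obtains h :: "'a \<Rightarrow> real ^ 'n" where "\<And>x y. x \<in> V \<Longrightarrow> y \<in> V \<Longrightarrow> h x \<bullet> h y = g x y"
proof -
  \<comment> \<open>A type with \<open>m (m + 1)\<close> elements, which indexes the rows of the Gram matrix.\<close>
  have "card (UNIV :: ('n \<times> 'n option) set) = card V"
    unfolding card_V UNIV_Times_UNIV[symmetric] card_cartesian_product
    by (simp add: m card_UNIV_option)
  then obtain e :: "'n \<times> 'n option \<Rightarrow> 'a" where e: "bij_betw e UNIV V"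
    using finite_same_card_bij[OF finite finite_V] by blast
  have eV: "e i \<in> V" for i
    using e by (auto simp: bij_betw_def)
  define c where "c = real m + 1"
  have c: "c > 0" by (simp add: c_def)
  define M where "M = (\<lambda>v :: real ^ ('n \<times> 'n option). \<chi> i. (\<Sum>j\<in>UNIV. g (e i) (e j) / c * v $ j))"
  have M_axis: "M (axis j 1) $ i = g (e i) (e j) / c" for i j
    by (simp add: M_def axis_def if_distrib[of "\<lambda>t. _ * t"] if_distrib[of "\<lambda>t. t / c"] cong: if_cong)
  have square: "(\<Sum>j\<in>UNIV. g (e i) (e j) / c * (g (e j) (e k) / c)) = g (e i) (e k) / c" for i k
  proof -
    have "(\<Sum>j\<in>UNIV. g (e i) (e j) * g (e j) (e k)) = c * g (e i) (e k)"
      using sum.reindex_bij_betw[OF e, of "\<lambda>z. g (e i) z * g z (e k)"] gram_square[OF eV eV]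
      by (simp add: c_def)
    then have "(\<Sum>j\<in>UNIV. g (e i) (e j) * g (e j) (e k)) / (c * c) = g (e i) (e k) / c"
      using c by simp
    then show ?thesis
      by (simp add: sum_divide_distrib)
  qed
  obtain B where B: "finite B" "real (card B) = (\<Sum>i\<in>UNIV. M (axis i 1) $ i)"
    "\<And>v w. v \<bullet> M w = (\<Sum>b\<in>B. (v \<bullet> b) * (w \<bullet> b))"
  proof (rule self_adjoint_idempotent_decomposition[of M])
    show "linear M"
      by (intro linearI) (simp_all add: M_def vec_eq_iff distrib_left add_divide_distrib sum.distrib sum_distrib_left
          mult.left_commute)
    show "M (M v) = M v" for v
    proof -
      have "M (M v) $ i = M v $ i" for i
      proof -
        have "M (M v) $ i = (\<Sum>j\<in>UNIV. \<Sum>k\<in>UNIV. g (e i) (e j) / c * (g (e j) (e k) / c) * v $ k)"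
          by (simp add: M_def sum_distrib_left sum_divide_distrib mult.assoc)
        also have "\<dots> = (\<Sum>k\<in>UNIV. (\<Sum>j\<in>UNIV. g (e i) (e j) / c * (g (e j) (e k) / c)) * v $ k)"
          by (subst sum.swap) (simp add: sum_distrib_right)
        also have "\<dots> = M v $ i"
          unfolding square by (simp add: M_def)
        finally show ?thesis .
      qed
      then show ?thesis by (simp add: vec_eq_iff)
    qed
    show "M v \<bullet> w = v \<bullet> M w" for v w
    proof -
      have "M v \<bullet> w = (\<Sum>i\<in>UNIV. \<Sum>j\<in>UNIV. g (e i) (e j) / c * v $ j * w $ i)"
        by (simp add: M_def inner_vec_def sum_distrib_right)
      also have "\<dots> = (\<Sum>j\<in>UNIV. \<Sum>i\<in>UNIV. g (e i) (e j) / c * v $ j * w $ i)"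
        by (rule sum.swap)
      also have "\<dots> = v \<bullet> M w"
        unfolding inner_vec_def M_def
        by (auto simp: sum_distrib_left gram_sym[OF eV eV] intro!: sum.cong)
      finally show ?thesis .
    qed
  qed (rule that)
  have index: "real (card (UNIV :: ('n \<times> 'n option) set)) = real m * c"
    using bij_betw_same_card[OF e] by (simp add: card_V c_def algebra_simps)
  have "real (card B) = real m"
    using B(2) c unfolding M_axis gram_self[OF eV] sum_constant index by simp
  then have "card (UNIV :: 'n set) = card B"
    by (simp add: m)
  then obtain \<beta> :: "'n \<Rightarrow> _" where \<beta>: "bij_betw \<beta> UNIV B"
    using finite_same_card_bij[OF finite B(1)] by blast
  define h where "h = (\<lambda>x. \<chi> j. sqrt c * \<beta> j $ inv e x)"
  have "h x \<bullet> h y = g x y" if xy: "x \<in> V" "y \<in> V" for x y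
  proof -
    have inv: "e (inv e z) = z" if "z \<in> V" for z
      using that e by (simp add: bij_betw_def f_inv_into_f)
    have "h x \<bullet> h y = c * (\<Sum>j\<in>UNIV. \<beta> j $ inv e x * \<beta> j $ inv e y)"
      using c by (simp add: h_def inner_vec_def sum_distrib_left mult_ac)
        (simp add: mult.assoc[symmetric])
    also have "(\<Sum>j\<in>UNIV. \<beta> j $ inv e x * \<beta> j $ inv e y) = (\<Sum>b\<in>B. b $ inv e x * b $ inv e y)"
      by (rule sum.reindex_bij_betw[OF \<beta>])
    also have "\<dots> = M (axis (inv e y) 1) $ inv e x"
      using B(3)[of "axis (inv e x) 1" "axis (inv e y) 1"] by (simp add: inner_axis')
    also have "c * \<dots> = g x y"
      using c xy by (simp add: M_axis inv)
    finally show ?thesis .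
  qed
  then show ?thesis by (rule that)
qed

section \<open>Isometries between tight frames\<close>

text \<open>Expanding \<open>v\<close> in the frame \<open>h\<close> and using the same coefficients for \<open>h'\<close> defines the isometry explicitly.\<close>

lemma isometry_of_equal_gram:
  fixes h h' :: "'a \<Rightarrow> 'b::euclidean_space"
  assumes c: "c \<noteq> 0"
    and gram: "\<And>x y. x \<in> V \<Longrightarrow> y \<in> V \<Longrightarrow> h x \<bullet> h y = h' x \<bullet> h' y"
    and frame: "\<And>v w. (\<Sum>x\<in>V. (v \<bullet> h x) * (h x \<bullet> w)) = c * (v \<bullet> w)"
    and frame': "\<And>v w. (\<Sum>x\<in>V. (v \<bullet> h' x) * (h' x \<bullet> w)) = c * (v \<bullet> w)"
  obtains f where "orthogonal_transformation f" "\<And>x. x \<in> V \<Longrightarrow> f (h x) = h' x"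
proof -
  define f where "f = (\<lambda>v. (1 / c) *\<^sub>R (\<Sum>x\<in>V. (v \<bullet> h x) *\<^sub>R h' x))"
  have lin: "linear f"
    by (intro linearI) (simp_all add: f_def inner_add_left scaleR_add_left sum.distrib
        add_divide_distrib scaleR_add_right scaleR_sum_right mult.left_commute)
  have f_h: "f (h x) = h' x" if x: "x \<in> V" for x
  proof -
    have "f (h x) \<bullet> w = h' x \<bullet> w" for w
    proof -
      have "f (h x) \<bullet> w = (1 / c) * (\<Sum>y\<in>V. (h' x \<bullet> h' y) * (h' y \<bullet> w))"
        using gram[OF x] by (simp add: f_def inner_sum_left)
      then show ?thesis
        using c by (simp add: frame')
    qed
    then show ?thesis by (metis vector_eq_rdot)
  qed
  have "f v \<bullet> f w = v \<bullet> w" for v w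
  proof -
    have "f v \<bullet> f w = (1 / c) * (\<Sum>x\<in>V. (w \<bullet> h x) * (f v \<bullet> h' x))"
      by (subst (2) f_def) (simp add: inner_sum_right)
    also have "(\<Sum>x\<in>V. (w \<bullet> h x) * (f v \<bullet> h' x)) = (\<Sum>x\<in>V. (w \<bullet> h x) * (h x \<bullet> v))"
    proof (intro sum.cong refl)
      fix x assume x: "x \<in> V"
      have "f v \<bullet> h' x = (1 / c) * (\<Sum>y\<in>V. (v \<bullet> h y) * (h' y \<bullet> h' x))"
        by (simp add: f_def inner_sum_left)
      also have "\<dots> = (1 / c) * (\<Sum>y\<in>V. (v \<bullet> h y) * (h y \<bullet> h x))"
        using gram x by simp
      finally show "(w \<bullet> h x) * (f v \<bullet> h' x) = (w \<bullet> h x) * (h x \<bullet> v)"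
        using c by (simp add: frame inner_commute)
    qed
    finally show ?thesis
      unfolding frame using c by (simp add: inner_commute)
  qed
  then have "orthogonal_transformation f"
    using lin by (simp add: orthogonal_transformation_def)
  then show ?thesis using f_h by (rule that)
qed

section \<open>Isomorphisms of graphs\<close>

lemma digraph_iso_with_proj_iff:
  assumes "pair_graph G" "pair_graph H"
  shows "digraph_iso (with_proj G) (with_proj H) \<longleftrightarrow>
    (\<exists>\<phi>. bij_betw \<phi> (pverts G) (pverts H) \<and>
      (\<forall>x\<in>pverts G. \<forall>y\<in>pverts G. (x, y) \<in> parcs G \<longleftrightarrow> (\<phi> x, \<phi> y) \<in> parcs H))"
proof
  interpret G: pair_graph G by fact
  assume "digraph_iso (with_proj G) (with_proj H)"
  then obtain f where f: "pre_digraph.digraph_isomorphism (with_proj G) f"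
    and H: "with_proj H = app_iso f (with_proj G)"
    by (auto simp: digraph_iso_def)
  let ?\<phi> = "iso_verts f"
  have verts: "pverts H = ?\<phi> ` pverts G" and arcs: "parcs H = iso_arcs f ` parcs G"
    and tail: "iso_tail f = fst" and head: "iso_head f = snd"
    using arg_cong[OF H, of verts] arg_cong[OF H, of arcs] arg_cong[OF H, of tail]
      arg_cong[OF H, of head] by simp_all
  have inj: "inj_on ?\<phi> (pverts G)"
    using f by (simp add: pre_digraph.digraph_isomorphism_def)
  have arc: "iso_arcs f a = (?\<phi> (fst a), ?\<phi> (snd a))" if "a \<in> parcs G" for a
    using f that by (simp add: pre_digraph.digraph_isomorphism_def tail head prod_eq_iff)
  have "(x, y) \<in> parcs G \<longleftrightarrow> (?\<phi> x, ?\<phi> y) \<in> parcs H" if xy: "x \<in> pverts G" "y \<in> pverts G" for x y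
  proof
    assume "(x, y) \<in> parcs G"
    then show "(?\<phi> x, ?\<phi> y) \<in> parcs H"
      using arc[of "(x, y)"] by (auto simp: arcs image_iff intro!: bexI[of _ "(x, y)"])
  next
    assume "(?\<phi> x, ?\<phi> y) \<in> parcs H"
    then obtain x' y' where a: "(x', y') \<in> parcs G" "(?\<phi> x, ?\<phi> y) = iso_arcs f (x', y')"
      by (auto simp: arcs)
    then have "?\<phi> x = ?\<phi> x'" "?\<phi> y = ?\<phi> y'"
      using arc by auto
    then show "(x, y) \<in> parcs G"
      using a(1) xy inj G.in_arcsD1[OF a(1)] G.in_arcsD2[OF a(1)] by (metis inj_onD)
  qed
  then show "\<exists>\<phi>. bij_betw \<phi> (pverts G) (pverts H) \<and>
      (\<forall>x\<in>pverts G. \<forall>y\<in>pverts G. (x, y) \<in> parcs G \<longleftrightarrow> (\<phi> x, \<phi> y) \<in> parcs H)"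
    using inj verts by (auto simp: bij_betw_def intro!: exI[of _ ?\<phi>])
next
  interpret G: pair_graph G by fact
  interpret H: pair_graph H by fact
  assume "\<exists>\<phi>. bij_betw \<phi> (pverts G) (pverts H) \<and>
      (\<forall>x\<in>pverts G. \<forall>y\<in>pverts G. (x, y) \<in> parcs G \<longleftrightarrow> (\<phi> x, \<phi> y) \<in> parcs H)"
  then obtain \<phi> where \<phi>: "inj_on \<phi> (pverts G)" "\<phi> ` pverts G = pverts H"
    and arcs: "\<And>x y. x \<in> pverts G \<Longrightarrow> y \<in> pverts G \<Longrightarrow> (x, y) \<in> parcs G \<longleftrightarrow> (\<phi> x, \<phi> y) \<in> parcs H"
    by (auto simp: bij_betw_def)
  define f where "f = \<lparr>iso_verts = \<phi>, iso_arcs = map_prod \<phi> \<phi>, iso_head = snd, iso_tail = fst\<rparr>"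
  have "parcs G \<subseteq> pverts G \<times> pverts G"
    using G.in_arcsD1 G.in_arcsD2 by auto
  then have "inj_on (map_prod \<phi> \<phi>) (parcs G)"
    using map_prod_inj_on[OF \<phi>(1) \<phi>(1)] inj_on_subset by blast
  then have "pre_digraph.digraph_isomorphism (with_proj G) f"
    using \<phi>(1) G.wf_digraph_axioms by (simp add: pre_digraph.digraph_isomorphism_def f_def)
  moreover have "map_prod \<phi> \<phi> ` parcs G = parcs H"
  proof (intro set_eqI iffI)
    fix a assume "a \<in> map_prod \<phi> \<phi> ` parcs G"
    then obtain x y where "(x, y) \<in> parcs G" "a = (\<phi> x, \<phi> y)"
      by auto
    then show "a \<in> parcs H"
      using arcs[of x y] G.in_arcsD1 G.in_arcsD2 by auto
  next
    fix a assume a: "a \<in> parcs H"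
    then have "fst a \<in> \<phi> ` pverts G" "snd a \<in> \<phi> ` pverts G"
      using H.arc_fst_in_verts H.arc_snd_in_verts \<phi>(2) by auto
    then obtain x y where xy: "x \<in> pverts G" "y \<in> pverts G" "a = (\<phi> x, \<phi> y)"
      by (metis imageE prod.collapse)
    then have "(x, y) \<in> parcs G" using a arcs by simp
    then show "a \<in> map_prod \<phi> \<phi> ` parcs G"
      using xy by (auto simp: image_iff intro!: bexI[of _ "(x, y)"])
  qed
  then have "with_proj H = app_iso f (with_proj G)"
    using \<phi>(2) by (simp add: app_iso_def f_def with_proj_def)
  ultimately show "digraph_iso (with_proj G) (with_proj H)"
    by (auto simp: digraph_iso_def)
qed

text \<open>The adjacency relation alone determines the Gram matrix: having a common neighbour separates the values
  \<open>- angle_cos m\<close> and \<open>-1\<close>. Hence graph isomorphisms preserve inner products.\<close>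

lemma (in taylor_gram_graph) gram_eq_adjacency:
  assumes xy: "x \<in> V" "y \<in> V"
  shows "g x y = (if x = y then 1 else if (x, y) \<in> parcs G then angle_cos m
    else if \<exists>z\<in>V. (x, z) \<in> parcs G \<and> (z, y) \<in> parcs G then - angle_cos m else -1)"
proof -
  have a: "0 < angle_cos m" "angle_cos m < 1"
    by (rule angle_cos_bounds)+
  show ?thesis
  proof (cases rule: gram_cases[OF xy])
    case 4
    obtain z where "z \<in> V" "g x z = angle_cos m" "g z y = angle_cos m"
      using common_nbr xy 4 by blast
    then have "\<exists>z\<in>V. (x, z) \<in> parcs G \<and> (z, y) \<in> parcs G"
      using xy by (auto simp: parcs_eq)
    moreover have "x \<noteq> y" "(x, y) \<notin> parcs G"
      using 4 a xy by (auto simp: parcs_eq gram_self)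
    ultimately show ?thesis
      using 4 by simp
  next
    case 2
    have "g z y = - g x z" if "z \<in> V" for z
      using that 2 xy by (simp add: gram_antipode_right gram_sym)
    then have "\<not> (\<exists>z\<in>V. (x, z) \<in> parcs G \<and> (z, y) \<in> parcs G)"
      using a by (auto simp: parcs_eq)
    moreover have "x \<noteq> y" "(x, y) \<notin> parcs G"
      using 2 a xy antipode_neq[OF xy(1)] by (auto simp: parcs_eq)
    ultimately show ?thesis
      using 2(1) by (simp only: if_False)
  qed (use a xy in \<open>auto simp: parcs_eq gram_self\<close>)
qed

section \<open>The correspondence\<close>

definition realizes :: "('a \<Rightarrow> real ^ 'n::finite) \<Rightarrow> 'a pair_pre_digraph \<Rightarrow> (real ^ 'n) set \<Rightarrow> bool" where
  "realizes h G \<Omega> \<longleftrightarrow> bij_betw h (pverts G) \<Omega> \<and>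
    parcs G = {(x, y). x \<in> pverts G \<and> y \<in> pverts G \<and> h x \<bullet> h y = angle_cos CARD('n)}"

lemma realizes_imp_taylor_gram_graph:
  fixes h :: "'a \<Rightarrow> real ^ 'n::finite"
  assumes "realizes h G \<Omega>" "tight_spherical_5_design \<Omega>" "CARD('n) \<ge> 3"
  obtains \<tau> where "taylor_gram_graph CARD('n) (pverts G) (\<lambda>x y. h x \<bullet> h y) \<tau> G"
proof -
  have "taylor_gram CARD('n) \<Omega> (\<bullet>) uminus"
    using assms by (intro tight_spherical_5_design_imp_gram)
  then have "taylor_gram CARD('n) (pverts G) (\<lambda>x y. h x \<bullet> h y) (\<lambda>x. inv_into (pverts G) h (- h x))"
    using assms(1) unfolding realizes_def by (intro taylor_gram_pullback) auto
  then show ?thesis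
    using assms(1) by (intro that taylor_gram_graph.intro taylor_gram_graph_axioms.intro)
      (auto simp: realizes_def)
qed

lemma realizable_tight_design:
  fixes \<Omega> :: "(real ^ 'n::finite) set"
  assumes "tight_spherical_5_design \<Omega>"
  obtains h and G :: "nat pair_pre_digraph" where "realizes h G \<Omega>"
proof -
  have "finite \<Omega>"
    using assms by (simp add: tight_spherical_5_design_def spherical_design_def)
  then obtain h where h: "bij_betw h {0..<card \<Omega>} \<Omega>"
    using ex_bij_betw_nat_finite by blast
  define G where "G = \<lparr>pverts = {0..<card \<Omega>},
    parcs = {(x, y). x \<in> {0..<card \<Omega>} \<and> y \<in> {0..<card \<Omega>} \<and> h x \<bullet> h y = angle_cos CARD('n)}\<rparr>"
  have "realizes h G \<Omega>"
    using h by (simp add: realizes_def G_def)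
  then show ?thesis by (rule that)
qed

lemma realizable_taylor_graph:
  assumes "taylor_graph G" "taylor_array CARD('n::finite) G" "CARD('n) \<ge> 3"
  obtains h :: "'a \<Rightarrow> real ^ 'n" and \<Omega> where "tight_spherical_5_design \<Omega>" "realizes h G \<Omega>"
proof -
  obtain g \<tau> where "taylor_gram_graph CARD('n) (pverts G) g \<tau> G"
    using taylor_graph_imp_gram[OF assms] by blast
  then interpret taylor_gram_graph "CARD('n)" "pverts G" g \<tau> G .
  obtain h :: "'a \<Rightarrow> real ^ 'n" where h: "\<And>x y. x \<in> pverts G \<Longrightarrow> y \<in> pverts G \<Longrightarrow> h x \<bullet> h y = g x y"
    using realization[OF refl] by blast
  have inj: "inj_on h (pverts G)"
  proof (rule inj_onI)
    fix x y assume xy: "x \<in> pverts G" "y \<in> pverts G" "h x = h y"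
    then have "g x y = g x x"
      using h by metis
    then show "x = y"
      using xy by (simp add: gram_self gram_eq_1)
  qed
  then have bij: "bij_betw h (pverts G) (h ` pverts G)"
    by (rule inj_on_imp_bij_betw)
  have "taylor_gram CARD('n) (h ` pverts G)
      (\<lambda>u v. g (inv_into (pverts G) h u) (inv_into (pverts G) h v))
      (\<lambda>u. inv_into (h ` pverts G) (inv_into (pverts G) h) (\<tau> (inv_into (pverts G) h u)))"
    using taylor_gram_axioms bij_betw_inv_into[OF bij] by (rule taylor_gram_pullback)
  moreover have "taylor_gram CARD('n) (h ` pverts G) (\<bullet>) \<tau>'
    = taylor_gram CARD('n) (h ` pverts G)
      (\<lambda>u v. g (inv_into (pverts G) h u) (inv_into (pverts G) h v)) \<tau>'" for \<tau>'
  proof -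
    have "u \<bullet> v = g (inv_into (pverts G) h u) (inv_into (pverts G) h v)"
      if "u \<in> h ` pverts G" "v \<in> h ` pverts G" for u v
      using that h inj by auto
    then show ?thesis
      unfolding taylor_gram_def taylor_gram_axioms_def antipodal_gram_def
      by (auto cong: conj_cong)
  qed
  ultimately have "tight_spherical_5_design (h ` pverts G)"
    by (intro gram_imp_tight_spherical_5_design) blast
  moreover have "realizes h G (h ` pverts G)"
    using bij h by (auto simp: realizes_def parcs_eq)
  ultimately show ?thesis by (rule that)
qed

text \<open>An isomorphism preserves the Gram matrix, so it extends to an isometry of the two tight frames; conversely, an
  orthogonal map preserves inner products, hence adjacency.\<close>

lemma realizes_equivalence:
  fixes h h' :: "'a \<Rightarrow> real ^ 'n::finite"
  assumes R: "realizes h G \<Omega>" and R': "realizes h' G' \<Omega>'"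
    and tight: "tight_spherical_5_design \<Omega>" "tight_spherical_5_design \<Omega>'" and m: "CARD('n) \<ge> 3"
  shows "(\<Omega>, \<Omega>') \<in> orthogonal_equivalence \<longleftrightarrow> (G, G') \<in> graph_isomorphism_rel"
proof -
  obtain \<tau> where "taylor_gram_graph CARD('n) (pverts G) (\<lambda>x y. h x \<bullet> h y) \<tau> G"
    using realizes_imp_taylor_gram_graph[OF R tight(1) m] .
  then interpret T: taylor_gram_graph "CARD('n)" "pverts G" "\<lambda>x y. h x \<bullet> h y" \<tau> G .
  obtain \<tau>' where "taylor_gram_graph CARD('n) (pverts G') (\<lambda>x y. h' x \<bullet> h' y) \<tau>' G'"
    using realizes_imp_taylor_gram_graph[OF R' tight(2) m] .
  then interpret T': taylor_gram_graph "CARD('n)" "pverts G'" "\<lambda>x y. h' x \<bullet> h' y" \<tau>' G' .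
  have h: "bij_betw h (pverts G) \<Omega>" and h': "bij_betw h' (pverts G') \<Omega>'"
    using R R' by (simp_all add: realizes_def)
  let ?iso = "\<lambda>\<phi>. bij_betw \<phi> (pverts G) (pverts G') \<and>
      (\<forall>x\<in>pverts G. \<forall>y\<in>pverts G. (x, y) \<in> parcs G \<longleftrightarrow> (\<phi> x, \<phi> y) \<in> parcs G')"
  have iso: "(G, G') \<in> graph_isomorphism_rel \<longleftrightarrow> (\<exists>\<phi>. ?iso \<phi>)"
    using digraph_iso_with_proj_iff[OF T.pair_graph_G T'.pair_graph_G] T.pair_graph_G T'.pair_graph_G
    by (simp add: graph_isomorphism_rel_def)
  show ?thesis
  proof
    assume "(\<Omega>, \<Omega>') \<in> orthogonal_equivalence"
    then obtain f where f: "orthogonal_transformation f" "f ` \<Omega> = \<Omega>'"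
      by (auto simp: orthogonal_equivalence_def)
    define \<phi> where "\<phi> = inv_into (pverts G') h' \<circ> (f \<circ> h)"
    have "bij_betw f \<Omega> \<Omega>'"
      using f orthogonal_transformation_inj[OF f(1)] by (auto simp: bij_betw_def intro: inj_on_subset)
    then have \<phi>: "bij_betw \<phi> (pverts G) (pverts G')"
      unfolding \<phi>_def by (intro bij_betw_trans[OF bij_betw_trans[OF h] bij_betw_inv_into[OF h']])
    have h'_\<phi>: "h' (\<phi> x) = f (h x)" if "x \<in> pverts G" for x
    proof -
      have "f (h x) \<in> h' ` pverts G'"
        using that h h' f(2) by (auto simp: bij_betw_def)
      then show ?thesis
        by (simp add: \<phi>_def f_inv_into_f)
    qed
    have "?iso \<phi>"
    proof (intro conjI ballI \<phi>)
      fix x y assume xy: "x \<in> pverts G" "y \<in> pverts G"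
      then have "\<phi> x \<in> pverts G'" "\<phi> y \<in> pverts G'"
        using \<phi> by (auto simp: bij_betw_def)
      moreover have "h' (\<phi> x) \<bullet> h' (\<phi> y) = h x \<bullet> h y"
        using f(1) xy by (simp add: h'_\<phi> orthogonal_transformation_def)
      ultimately show "(x, y) \<in> parcs G \<longleftrightarrow> (\<phi> x, \<phi> y) \<in> parcs G'"
        using xy by (simp add: T.parcs_eq T'.parcs_eq)
    qed
    then show "(G, G') \<in> graph_isomorphism_rel"
      unfolding iso by blast
  next
    assume "(G, G') \<in> graph_isomorphism_rel"
    then obtain \<phi> where \<phi>: "bij_betw \<phi> (pverts G) (pverts G')"
      and arcs: "\<And>x y. x \<in> pverts G \<Longrightarrow> y \<in> pverts G \<Longrightarrow> (x, y) \<in> parcs G \<longleftrightarrow> (\<phi> x, \<phi> y) \<in> parcs G'"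
      unfolding iso by blast
    have in': "\<phi> x \<in> pverts G'" if "x \<in> pverts G" for x
      using that \<phi> by (auto simp: bij_betw_def)
    have h'\<phi>: "bij_betw (h' \<circ> \<phi>) (pverts G) \<Omega>'"
      using \<phi> h' by (rule bij_betw_trans)
    have gram: "h x \<bullet> h y = (h' \<circ> \<phi>) x \<bullet> (h' \<circ> \<phi>) y" if xy: "x \<in> pverts G" "y \<in> pverts G" for x y
    proof -
      have "x = y \<longleftrightarrow> \<phi> x = \<phi> y"
        using \<phi> xy by (auto simp: bij_betw_def dest: inj_onD)
      moreover have "(\<exists>z\<in>pverts G'. (\<phi> x, z) \<in> parcs G' \<and> (z, \<phi> y) \<in> parcs G')
          \<longleftrightarrow> (\<exists>z\<in>pverts G. (x, z) \<in> parcs G \<and> (z, y) \<in> parcs G)"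
        unfolding bij_betw_imp_surj_on[OF \<phi>, symmetric]
        using arcs[OF xy(1)] arcs[OF _ xy(2)] by auto
      ultimately show ?thesis
        using T.gram_eq_adjacency[OF xy] T'.gram_eq_adjacency[OF in'[OF xy(1)] in'[OF xy(2)]]
          arcs[OF xy] by simp
    qed
    have frame: "(\<Sum>x\<in>pverts G. (v \<bullet> h x) * (h x \<bullet> w)) = (real CARD('n) + 1) * (v \<bullet> w)" for v w
      using sum.reindex_bij_betw[OF h, of "\<lambda>z. (v \<bullet> z) * (z \<bullet> w)"]
        tight_spherical_5_design_frame[OF tight(1), of v w] by simp
    have frame': "(\<Sum>x\<in>pverts G. (v \<bullet> (h' \<circ> \<phi>) x) * ((h' \<circ> \<phi>) x \<bullet> w)) = (real CARD('n) + 1) * (v \<bullet> w)" for v w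
      using sum.reindex_bij_betw[OF h'\<phi>, of "\<lambda>z. (v \<bullet> z) * (z \<bullet> w)"]
        tight_spherical_5_design_frame[OF tight(2), of v w] by simp
    obtain f where f: "orthogonal_transformation f" "\<And>x. x \<in> pverts G \<Longrightarrow> f (h x) = (h' \<circ> \<phi>) x"
      by (rule isometry_of_equal_gram[OF _ gram frame frame']) auto
    have "f ` \<Omega> = f ` h ` pverts G"
      using h by (simp add: bij_betw_def)
    also have "\<dots> = (h' \<circ> \<phi>) ` pverts G"
      unfolding image_image using f(2) by (intro image_cong) auto
    also have "\<dots> = \<Omega>'"
      using h'\<phi> by (simp add: bij_betw_def)
    finally show "(\<Omega>, \<Omega>') \<in> orthogonal_equivalence"
      using f(1) by (auto simp: orthogonal_equivalence_def)
  qed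
qed

text \<open>Send the class of \<open>a\<close> to the class of any \<open>b\<close> related to \<open>a\<close>: compatibility makes this well defined and injective.\<close>

lemma bij_betw_quotients:
  assumes r: "equiv A' r" "A \<subseteq> A'" and s: "equiv B' s" "B \<subseteq> B'"
    and left: "\<And>a. a \<in> A \<Longrightarrow> \<exists>b\<in>B. R a b"
    and right: "\<And>b. b \<in> B \<Longrightarrow> \<exists>a\<in>A. R a b"
    and compat: "\<And>a a' b b'. \<lbrakk>a \<in> A; a' \<in> A; b \<in> B; b' \<in> B; R a b; R a' b'\<rbrakk>
      \<Longrightarrow> (a, a') \<in> r \<longleftrightarrow> (b, b') \<in> s"
  shows "\<exists>F. bij_betw F (A // r) (B // s)"
proof -
  obtain c where c: "\<And>a. a \<in> A \<Longrightarrow> c a \<in> B \<and> R a (c a)"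
    using left by metis
  have r_eq: "r `` {a} = r `` {a'} \<longleftrightarrow> (a, a') \<in> r" if "a \<in> A" "a' \<in> A" for a a'
    using that r by (intro eq_equiv_class_iff[OF r(1)]) auto
  have s_eq: "s `` {b} = s `` {b'} \<longleftrightarrow> (b, b') \<in> s" if "b \<in> B" "b' \<in> B" for b b'
    using that s by (intro eq_equiv_class_iff[OF s(1)]) auto
  have class_eq: "s `` {c a} = s `` {c a'} \<longleftrightarrow> r `` {a} = r `` {a'}" if "a \<in> A" "a' \<in> A" for a a'
    using that c compat[of a a' "c a" "c a'"] by (simp add: r_eq s_eq)
  define F where "F = (\<lambda>X. s `` {c (SOME a. a \<in> A \<and> X = r `` {a})})"
  have F: "F (r `` {a}) = s `` {c a}" if "a \<in> A" for a
  proof -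
    have "\<exists>a'. a' \<in> A \<and> r `` {a} = r `` {a'}"
      using that by blast
    from someI_ex[OF this] show ?thesis
      unfolding F_def using that by (subst class_eq) auto
  qed
  have "bij_betw F (A // r) (B // s)"
    unfolding bij_betw_def
  proof
    show "inj_on F (A // r)"
      by (rule inj_onI) (auto simp: F class_eq elim!: quotientE)
    show "F ` (A // r) = B // s"
    proof (intro set_eqI iffI)
      fix Y assume "Y \<in> F ` (A // r)"
      then show "Y \<in> B // s"
        using c by (auto simp: F elim!: quotientE intro!: quotientI)
    next
      fix Y assume "Y \<in> B // s"
      then obtain b where b: "b \<in> B" "Y = s `` {b}"
        by (rule quotientE)
      obtain a where a: "a \<in> A" "R a b"
        using right b(1) by blast
      have "(a, a) \<in> r"
        using a(1) r by (meson equivE refl_onD subsetD)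
      then have "(b, c a) \<in> s"
        using compat[of a a b "c a"] a b(1) c by simp
      then have "Y = F (r `` {a})"
        using a b c by (simp add: F s_eq)
      then show "Y \<in> F ` (A // r)"
        using a(1) by (auto intro: quotientI)
    qed
  qed
  then show ?thesis by blast
qed

theorem corollary5p5:
  fixes m :: nat
  assumes "m \<ge> 3" and "CARD('n::finite) = m"
  shows "\<exists>F. bij_betw F
    ({\<Omega> :: (real ^ 'n) set. tight_spherical_5_design \<Omega>} // orthogonal_equivalence)
    ({G :: nat pair_pre_digraph. taylor_graph G \<and> \<not> bipartite G \<and>
        (\<exists>k \<mu>. real k = (real m - 1) * (real m + 2) / 2 \<and>
          real \<mu> = ((real m)\<^sup>2 + real m - 4 - (real m - 3) * sqrt (real m + 2)) / 4 \<and>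
          has_intersection_array G [k, \<mu>, 1] [1, \<mu>, k])} // graph_isomorphism_rel)"
proof (rule bij_betw_quotients[OF equiv_orthogonal_equivalence _ equiv_graph_isomorphism_rel,
      where R = "\<lambda>\<Omega> G. \<exists>h. realizes h G \<Omega>"], goal_cases)
  case 2
  show ?case by (auto simp: has_intersection_array_def)
next
  case (3 \<Omega>)
  then have tight: "tight_spherical_5_design \<Omega>" by simp
  obtain h and G :: "nat pair_pre_digraph" where R: "realizes h G \<Omega>"
    using realizable_tight_design[OF tight] by blast
  obtain \<tau> where "taylor_gram_graph CARD('n) (pverts G) (\<lambda>x y. h x \<bullet> h y) \<tau> G"
    using realizes_imp_taylor_gram_graph[OF R tight] assms by auto
  then interpret taylor_gram_graph m "pverts G" "\<lambda>x y. h x \<bullet> h y" \<tau> G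
    using assms by simp
  show ?case
    using taylor_graph_G not_bipartite_G taylor_array_G R
    unfolding taylor_array_def taylor_mu_def by blast
next
  case (4 G)
  then have "taylor_graph G" "taylor_array m G"
    by (auto simp: taylor_array_def taylor_mu_def)
  then obtain h :: "nat \<Rightarrow> real ^ 'n" and \<Omega> where "tight_spherical_5_design \<Omega>" "realizes h G \<Omega>"
    using realizable_taylor_graph[where 'n = 'n and G = G] assms by blast
  then show ?case by blast
next
  case (5 \<Omega> \<Omega>' G G')
  then show ?case
    using realizes_equivalence assms by blast
qed simp

end
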